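(* There exists an absolute constant $c>0$ such that the following holds for every $n\ge 1$ and every orthonormal basis $\{e_1,\ldots,e_n\}$ of $\mathbf{R}^n$. Let $E$ be an ellipsoid in $\mathbf{R}^n$ and assume that both $E$ and $E^o$ are in $M_{\delta}$-position. Then for every $r>0$ and every $\tau\in(0,1)$, $$t_c(E,r)+t_c\left(E^o,\frac{u(\tau,\delta)}{r}\right)\ge(1-\tau)n,$$ where $$u(\tau,\delta)=\frac{c\log\left(\frac2\tau\right)}{\sqrt\tau}\,\exp\left(\frac{c\,\delta\log^2\left(\frac2\tau\right)}{\tau}\right).$$
   Context: $\mathbf{R}^n$ carries an inner product $\langle\cdot,\cdot\rangle$ with Euclidean norm $|\cdot|$ and unit ball $D=D_n$. Ellipsoids are non-degenerate and origin-centred. For a symmetric convex body $K$ in $\mathbf{R}^n$: $\|\cdot\|_K$ is the norm with unit ball $K$; $K^o=\{y:\langle y,x\rangle\le1\text{ for every }x\in K\}$ is the polar body; $\lambda_K=(|K|/|D|)^{1/n}$ is the volume radius ($|\cdot|$ of a body denotes volume); for convex bodies $A,B$, $N(A,B)$ is the smallest natural number $N$ for which there exist $x_1,\ldots,x_N\in\mathbf{R}^n$ with $A\subseteq\bigcup_{i\le N}(x_i+B)$; $N_K=N(K,\lambda_KD)$. $K$ is in $M_{\delta}$-position if $\delta\ge\frac1n\log N_K$. A coordinate subspace is a subspace $\mathbf{R}^{\sigma}=\{x:\langle x,e_j\rangle=0\text{ if }j\notin\sigma\}$ with $\sigma\subseteq\{1,\ldots,n\}$. For $r>0$, $t_c(K,r)$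 is the maximum of all integers $0\le k\le n$ for which there exists a coordinate subspace $G$ with $\dim G=k$ such that $\frac1r|x|\le\|x\|_K$ for every $x\in G$. *)

theory Defs
  imports "HOL-Analysis.Analysis" "Jordan_Normal_Form.VS_Connect"
begin

text \<open>
  The constant in the theorem is chosen before the dimension, so the dimension has to be a
  natural number bound in the formula rather than an index type.  The space \<open>\<real>\<^sup>n\<close> is therefore
  \<open>carrier_vec n :: real vec set\<close> from \<open>Jordan_Normal_Form\<close>, with \<open>scalar_prod\<close> as inner product.
  The symbols shared with the type-indexed vectors of \<open>HOL-Analysis\<close> are freed below.
\<close>

no_notation vec_nth (infixl \<open>$\<close> 90)
no_notation inner (infix \<open>\<bullet>\<close> 70)

definition eucl_norm :: "real vec \<Rightarrow> real" where
  "eucl_norm x = sqrt (x \<bullet> x)"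

definition unit_ball :: "nat \<Rightarrow> real vec set" where
  "unit_ball n = {x \<in> carrier_vec n. eucl_norm x \<le> 1}"

definition ellipsoid :: "nat \<Rightarrow> real vec set \<Rightarrow> bool" where
  "ellipsoid n E \<longleftrightarrow>
     (\<exists>A \<in> carrier_mat n n. invertible_mat A \<and> E = (\<lambda>x. A *\<^sub>v x) ` unit_ball n)"

text \<open>For a symmetric convex body \<open>K\<close>, its Minkowski functional is the norm with unit ball \<open>K\<close>.\<close>

definition body_norm :: "real vec set \<Rightarrow> real vec \<Rightarrow> real" where
  "body_norm K x = Inf {t. t > 0 \<and> x \<in> (\<lambda>y. t \<cdot>\<^sub>v y) ` K}"

definition polar :: "nat \<Rightarrow> real vec set \<Rightarrow> real vec set" where
  "polar n K = {y \<in> carrier_vec n. \<forall>x\<in>K. y \<bullet> x \<le> 1}"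

text \<open>
  Lebesgue measure on \<open>carrier_vec n\<close> is transported from the product measure on \<open>{..<n}\<close>, whose
  points are functions that are \<open>undefined\<close> outside \<open>{..<n}\<close>; hence the \<open>restrict\<close>.
\<close>

definition volume :: "nat \<Rightarrow> real vec set \<Rightarrow> real" where
  "volume n K = measure (Pi\<^sub>M {..<n} (\<lambda>_. lborel))
                  ((\<lambda>x. restrict (\<lambda>i. x $ i) {..<n}) ` K)"

definition volume_radius :: "nat \<Rightarrow> real vec set \<Rightarrow> real" where
  "volume_radius n K = root n (volume n K / volume n (unit_ball n))"

definition covering_number :: "nat \<Rightarrow> real vec set \<Rightarrow> real vec set \<Rightarrow> nat" where
  "covering_number n A B =
     (LEAST N. \<exists>x :: nat \<Rightarrow> real vec.
        (\<forall>i<N. x i \<in> carrier_vec n) \<and> A \<subseteq> (\<Union>i<N. (\<lambda>b. x i + b) ` B))"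

definition M_position :: "nat \<Rightarrow> real \<Rightarrow> real vec set \<Rightarrow> bool" where
  "M_position n \<delta> K \<longleftrightarrow>
     \<delta> \<ge> 1 / real n *
        ln (real (covering_number n K ((\<lambda>x. volume_radius n K \<cdot>\<^sub>v x) ` unit_ball n)))"

definition orthonormal_basis :: "nat \<Rightarrow> (nat \<Rightarrow> real vec) \<Rightarrow> bool" where
  "orthonormal_basis n e \<longleftrightarrow>
     vectorspace.basis class_ring (module_vec TYPE(real) n) (e ` {..<n}) \<and>
     (\<forall>i<n. \<forall>j<n. e i \<bullet> e j = (if i = j then 1 else 0))"

definition coordinate_subspace :: "nat \<Rightarrow> (nat \<Rightarrow> real vec) \<Rightarrow> real vec set \<Rightarrow> bool" where
  "coordinate_subspace n e G \<longleftrightarrow>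
     (\<exists>\<sigma> \<subseteq> {..<n}. G = {x \<in> carrier_vec n. \<forall>j \<in> {..<n} - \<sigma>. x \<bullet> e j = 0})"

definition subspace_dim :: "nat \<Rightarrow> real vec set \<Rightarrow> nat" where
  "subspace_dim n G = vectorspace.dim class_ring ((module_vec TYPE(real) n)\<lparr>carrier := G\<rparr>)"

definition t_c :: "nat \<Rightarrow> (nat \<Rightarrow> real vec) \<Rightarrow> real vec set \<Rightarrow> real \<Rightarrow> nat" where
  "t_c n e K r =
     Max {k. k \<le> n \<and> (\<exists>G. coordinate_subspace n e G \<and> subspace_dim n G = k \<and>
                           (\<forall>x\<in>G. 1 / r * eucl_norm x \<le> body_norm K x))}"

definition u_bound :: "real \<Rightarrow> real \<Rightarrow> real \<Rightarrow> real" where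
  "u_bound c \<tau> \<delta> = c * ln (2 / \<tau>) / sqrt \<tau> * exp (c * \<delta> * (ln (2 / \<tau>))\<^sup>2 / \<tau>)"

end

theory Submission
  imports Defs
begin

text \<open>
  Everything reduces to one claim: if an ellipsoid \<open>K\<close> is in \<open>M\<^sub>\<delta>\<close>-position then
  \<open>t\<^sub>c(K, r) \<ge> (1 - s) n\<close> as soon as \<open>r \<ge> \<lambda>\<^sub>K \<phi>(s)\<close>, where
  \<open>\<phi>(s) = 4 exp(16\<delta>/s + 1/2) / \<surd>s\<close>.  Apply it to \<open>E\<close> and to its polar, whose volume radii are
  inverse to each other.  Either one of the two bodies alone provides \<open>(1 - \<tau>) n\<close>, or both radii
  are large enough for \<open>s = 1/2\<close> and each body provides \<open>n/2\<close>.

  For the claim, projecting a covering of \<open>K\<close> by balls of radius \<open>\<lambda>\<^sub>K\<close> onto the span of any set of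
  principal axes and comparing volumes bounds the product of the relative lengths of these axes by
  \<open>exp(\<delta>n)\<close>, so all but \<open>s n/16\<close> axes have relative length at most \<open>exp(16\<delta>/s + 1/2)\<close>.  The matrix of
  the quadratic form \<open>\<parallel>x\<parallel>\<^sub>K\<^sup>2\<close> in the basis \<open>e\<close> hence has few small eigenvalues, and a barrier
  argument in the style of Batson, Spielman and Srivastava deletes \<open>s n\<close> coordinates one at a time
  such that the remaining principal submatrix is bounded below.
\<close>

section \<open>Restricted invertibility by a barrier argument\<close>

text \<open>The section of \<open>K\<close> by the coordinate subspace has to lie in a ball of
  radius \<open>r\<close>, so only long axes of \<open>K\<close> obstruct. The long axes of the
  polar are the short axes of \<open>K\<close>, which a covering of \<open>K\<close> does not see
  directly; hence one hypothesis for each body. The case of two halves is what produces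
  \<open>1 / sqrt \<tau>\<close>. If for every \<open>r\<close> one of the bodies alone had to
  provide \<open>(1 - \<tau>) n\<close>, then \<open>u\<close> would have to be at least
  \<open>\<phi>(\<tau>)^2\<close>, with \<open>1 / \<tau>\<close> in front. When \<open>u\<close> is
  at least \<open>\<phi>(\<tau>) \<phi>(1/2)\<close>, a radius that misses its threshold for
  \<open>\<tau>\<close> pushes the other one beyond the threshold for \<open>1/2\<close>. The
  barrier argument sees a matrix only through the trace of an inverse, so it runs without a spectral
  theorem: inverses come from Schur complements, and the starting spectrum is explicit because the
  form is diagonal in the principal axes. Matrices are functions of two indices, and a principal
  submatrix is the same function on a smaller index set.\<close>

definition app :: "'a set \<Rightarrow> ('a \<Rightarrow> 'a \<Rightarrow> real) \<Rightarrow> ('a \<Rightarrow> real) \<Rightarrow> 'a \<Rightarrow> real" where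
  "app I M x i = (\<Sum>j\<in>I. M i j * x j)"

definition bil :: "'a set \<Rightarrow> ('a \<Rightarrow> 'a \<Rightarrow> real) \<Rightarrow> ('a \<Rightarrow> real) \<Rightarrow> ('a \<Rightarrow> real) \<Rightarrow> real" where
  "bil I M x y = (\<Sum>i\<in>I. x i * app I M y i)"

definition trace_on :: "'a set \<Rightarrow> ('a \<Rightarrow> 'a \<Rightarrow> real) \<Rightarrow> real" where
  "trace_on I B = (\<Sum>i\<in>I. B i i)"

definition sym_on :: "'a set \<Rightarrow> ('a \<Rightarrow> 'a \<Rightarrow> real) \<Rightarrow> bool" where
  "sym_on I M \<longleftrightarrow> (\<forall>i\<in>I. \<forall>j\<in>I. M i j = M j i)"

definition pos_def :: "'a set \<Rightarrow> ('a \<Rightarrow> 'a \<Rightarrow> real) \<Rightarrow> bool" where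
  "pos_def I M \<longleftrightarrow> (\<forall>x. (\<exists>i\<in>I. x i \<noteq> 0) \<longrightarrow> bil I M x x > 0)"

text \<open>One product suffices: both matrices being symmetric, transposing \<open>M B = 1\<close>
  gives \<open>B M = 1\<close>, the last fact of \<open>pd_inverseD\<close>. Positive definiteness
  is part of the bundle because, for a shifted matrix, it says that the barrier is still below the
  spectrum.\<close>

definition pd_inverse :: "'a set \<Rightarrow> ('a \<Rightarrow> 'a \<Rightarrow> real) \<Rightarrow> ('a \<Rightarrow> 'a \<Rightarrow> real) \<Rightarrow> bool" where
  "pd_inverse I M B \<longleftrightarrow> finite I \<and> sym_on I M \<and> sym_on I B \<and> pos_def I M \<and>
     (\<forall>i\<in>I. \<forall>k\<in>I. (\<Sum>j\<in>I. M i j * B j k) = (if i = k then 1 else 0))"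

definition shift :: "('a \<Rightarrow> 'a \<Rightarrow> real) \<Rightarrow> real \<Rightarrow> 'a \<Rightarrow> 'a \<Rightarrow> real" where
  "shift M b i j = M i j - (if i = j then b else 0)"

section \<open>Symmetric forms and inverses of positive definite matrices\<close>

lemma sym_onD: "sym_on I M \<Longrightarrow> i \<in> I \<Longrightarrow> j \<in> I \<Longrightarrow> M i j = M j i"
  by (simp add: sym_on_def)

lemma bil_cong: "(\<And>i. i \<in> I \<Longrightarrow> x i = x' i) \<Longrightarrow> (\<And>i. i \<in> I \<Longrightarrow> y i = y' i) \<Longrightarrow> bil I M x y = bil I M x' y'"
  by (simp add: bil_def app_def)

lemma bil_sym:
  assumes "sym_on I M"
  shows "bil I M x y = bil I M y x"
proof -
  have "bil I M x y = (\<Sum>i\<in>I. \<Sum>j\<in>I. x i * (M i j * y j))"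
    by (simp add: bil_def app_def sum_distrib_left)
  also have "\<dots> = (\<Sum>j\<in>I. \<Sum>i\<in>I. x i * (M i j * y j))"
    by (rule sum.swap)
  also have "\<dots> = (\<Sum>j\<in>I. \<Sum>i\<in>I. y j * (M j i * x i))"
    using assms by (intro sum.cong refl) (simp add: sym_on_def mult_ac)
  finally show ?thesis by (simp add: bil_def app_def sum_distrib_left)
qed

lemma bil_diff_left: "bil I M (\<lambda>i. x i - t * y i) z = bil I M x z - t * bil I M y z"
  by (simp add: bil_def app_def sum_distrib_left algebra_simps sum_subtractf)

lemma bil_diff_right: "bil I M z (\<lambda>i. x i - t * y i) = bil I M z x - t * bil I M z y"
  by (simp add: bil_def app_def sum_distrib_left algebra_simps sum_subtractf)

lemma pos_def_nonneg: "pos_def I M \<Longrightarrow> bil I M x x \<ge> 0"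
  by (cases "\<exists>i\<in>I. x i \<noteq> 0") (auto simp: pos_def_def less_imp_le bil_def)

lemma pd_inverseD:
  assumes "pd_inverse I M B"
  shows "finite I" "sym_on I M" "sym_on I B" "pos_def I M"
    and "\<And>i k. i \<in> I \<Longrightarrow> k \<in> I \<Longrightarrow> (\<Sum>j\<in>I. M i j * B j k) = (if i = k then 1 else 0)"
    and "\<And>i k. i \<in> I \<Longrightarrow> k \<in> I \<Longrightarrow> (\<Sum>j\<in>I. B i j * M j k) = (if i = k then 1 else 0)"
proof -
  show *: "finite I" "sym_on I M" "sym_on I B" "pos_def I M"
    "\<And>i k. i \<in> I \<Longrightarrow> k \<in> I \<Longrightarrow> (\<Sum>j\<in>I. M i j * B j k) = (if i = k then 1 else 0)"
    using assms by (auto simp: pd_inverse_def)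
  show "(\<Sum>j\<in>I. B i j * M j k) = (if i = k then 1 else 0)" if "i \<in> I" "k \<in> I" for i k
  proof -
    have "(\<Sum>j\<in>I. B i j * M j k) = (\<Sum>j\<in>I. M k j * B j i)"
      using that by (intro sum.cong refl) (simp add: sym_onD[OF *(2), of _ k] sym_onD[OF *(3), of i] mult.commute)
    then show ?thesis using *(5)[OF that(2,1)] by auto
  qed
qed

lemma app_inverse:
  assumes "pd_inverse I M B" "i \<in> I"
  shows "app I M (app I B y) i = y i"
proof -
  note D = pd_inverseD[OF assms(1)]
  have "app I M (app I B y) i = (\<Sum>j\<in>I. \<Sum>k\<in>I. M i j * B j k * y k)"
    by (simp add: app_def sum_distrib_left mult.assoc)
  also have "\<dots> = (\<Sum>k\<in>I. (\<Sum>j\<in>I. M i j * B j k) * y k)"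
    by (subst sum.swap) (simp add: sum_distrib_right)
  also have "\<dots> = (\<Sum>k\<in>I. if i = k then y k else 0)"
    using assms(2) D(5) by (intro sum.cong refl) auto
  finally show ?thesis using assms(2) D(1) by simp
qed

lemma bil_app_inverse:
  assumes "pd_inverse I M B"
  shows "bil I M x (app I B y) = (\<Sum>i\<in>I. x i * y i)"
  unfolding bil_def by (intro sum.cong refl) (simp add: app_inverse[OF assms])

lemma pd_inverse_nonneg:
  assumes "pd_inverse I M B"
  shows "bil I B y y \<ge> 0"
proof -
  have "bil I M (app I B y) (app I B y) = (\<Sum>i\<in>I. app I B y i * y i)"
    by (rule bil_app_inverse[OF assms])
  also have "\<dots> = bil I B y y" by (simp add: bil_def mult.commute)
  finally show ?thesis using pos_def_nonneg[OF pd_inverseD(4)[OF assms]] by metis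
qed

lemma app_delta: "finite I \<Longrightarrow> k \<in> I \<Longrightarrow> app I B (\<lambda>i. if i = k then 1 else 0) = (\<lambda>i. B i k)"
  by (simp add: app_def fun_eq_iff if_distrib[of "\<lambda>t. _ * t"] cong: if_cong)

text \<open>Column \<open>k\<close> of \<open>B\<close> is \<open>B e_k\<close>, so
  \<open>M B = 1\<close> collapses the form of \<open>M\<close> there to a diagonal entry, and the
  column cannot vanish.\<close>

lemma pd_inverse_diag:
  assumes "pd_inverse I M B" "k \<in> I"
  shows "bil I M (\<lambda>i. B i k) (\<lambda>i. B i k) = B k k" "B k k > 0"
proof -
  note D = pd_inverseD[OF assms(1)]
  have "bil I M (\<lambda>i. B i k) (\<lambda>i. B i k) = (\<Sum>i\<in>I. B i k * (if i = k then 1 else 0))"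
    using bil_app_inverse[OF assms(1), of "\<lambda>i. B i k" "\<lambda>i. if i = k then 1 else 0"]
    by (simp add: app_delta D assms(2))
  then show *: "bil I M (\<lambda>i. B i k) (\<lambda>i. B i k) = B k k"
    using D(1) assms(2) by (simp add: if_distrib cong: if_cong)
  have "\<exists>i\<in>I. B i k \<noteq> 0"
  proof (rule ccontr)
    assume "\<not> ?thesis"
    then have "(\<Sum>j\<in>I. M k j * B j k) = 0" by simp
    then show False using D(5)[OF assms(2,2)] by simp
  qed
  then show "B k k > 0" using D(4) * unfolding pos_def_def by metis
qed

text \<open>Cauchy-Schwarz in the inner product given by \<open>M\<close>: the functional
  \<open>x k\<close> is represented there by column \<open>k\<close> of \<open>B\<close>, whose
  squared length is \<open>B k k\<close>.\<close>

lemma pd_inverse_cauchy_schwarz: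
  assumes "pd_inverse I M B" "k \<in> I"
  shows "(x k)\<^sup>2 \<le> B k k * bil I M x x"
proof -
  note D = pd_inverseD[OF assms(1)]
  let ?b = "\<lambda>i. B i k"
  \<comment> \<open>The minimiser of the form of \<open>M\<close> at
    \<open>x - t ?b\<close>.\<close>
  define t where "t = x k / B k k"
  have xb: "bil I M x ?b = x k"
    using bil_app_inverse[OF assms(1), of x "\<lambda>i. if i = k then 1 else 0"] D(1) assms(2)
    by (simp add: app_delta if_distrib cong: if_cong)
  have bx: "bil I M ?b x = x k" using xb bil_sym[OF D(2)] by metis
  have "0 \<le> bil I M (\<lambda>i. x i - t * ?b i) (\<lambda>i. x i - t * ?b i)"
    by (rule pos_def_nonneg[OF D(4)])
  also have "\<dots> = bil I M x x - 2 * t * x k + t\<^sup>2 * B k k"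
    by (simp add: bil_diff_left bil_diff_right xb bx pd_inverse_diag(1)[OF assms] power2_eq_square algebra_simps)
  also have "\<dots> = bil I M x x - (x k)\<^sup>2 / B k k"
    using pd_inverse_diag(2)[OF assms] by (simp add: t_def power2_eq_square field_simps)
  finally show ?thesis using pd_inverse_diag(2)[OF assms] by (simp add: field_simps)
qed

text \<open>The least eigenvalue of \<open>M\<close> is at least the reciprocal of the trace of the
  inverse, so a bounded potential keeps the barrier at a definite distance below the
  spectrum.\<close>

lemma pd_inverse_lower_bound:
  assumes "pd_inverse I M B"
  shows "(\<Sum>i\<in>I. (x i)\<^sup>2) \<le> trace_on I B * bil I M x x"
  unfolding trace_on_def sum_distrib_right
  by (intro sum_mono) (rule pd_inverse_cauchy_schwarz[OF assms])

lemma bil_subset: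
  assumes "finite I" "J \<subseteq> I" 
  shows "bil I M (\<lambda>i. if i \<in> J then x i else 0) (\<lambda>i. if i \<in> J then y i else 0) = bil J M x y"
proof -
  have "app I M (\<lambda>i. if i \<in> J then y i else 0) i = app J M y i" for i
    unfolding app_def using assms by (intro sum.mono_neutral_cong_right) auto
  then show ?thesis unfolding bil_def using assms by (intro sum.mono_neutral_cong_right) auto
qed

lemma pos_def_subset:
  assumes "pos_def I M" "finite I" "J \<subseteq> I"
  shows "pos_def J M"
  unfolding pos_def_def
proof (intro allI impI)
  fix x :: "'a \<Rightarrow> real" assume "\<exists>i\<in>J. x i \<noteq> 0"
  then have "\<exists>i\<in>I. (if i \<in> J then x i else 0) \<noteq> 0" using assms(3) by auto
  then have "bil I M (\<lambda>i. if i \<in> J then x i else 0) (\<lambda>i. if i \<in> J then x i else 0) > 0"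
    by (rule assms(1)[unfolded pos_def_def, rule_format])
  then show "bil J M x x > 0" by (simp add: bil_subset[OF assms(2,3)])
qed

text \<open>Induction on the index set. The pivot added with \<open>p\<close> is a value of the form
  at a vector with entry 1 at \<open>p\<close>, hence positive.\<close>

lemma pos_def_inverse_exists:
  assumes "finite I" "sym_on I M" "pos_def I M"
  shows "\<exists>B. pd_inverse I M B"
  using assms
proof (induction I rule: finite_induct)
  case empty
  then show ?case by (auto simp: pd_inverse_def sym_on_def)
next
  case (insert p I)
  have "sym_on I M" "pos_def I M"
    using insert.prems pos_def_subset[of "insert p I" M I] insert.hyps by (auto simp: sym_on_def)
  then obtain B where B: "pd_inverse I M B" using insert.IH by blast
  note D = pd_inverseD[OF B]
  \<comment> \<open>\<open>w\<close> solves \<open>M w = M e_p\<close> on \<open>I\<close>, so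
    \<open>M\<close> maps \<open>e_p - w\<close> to a vector that vanishes on \<open>I\<close>; its
    entry at \<open>p\<close> is the Schur complement \<open>s\<close>.\<close>
  define w where "w = app I B (\<lambda>i. M i p)"
  define s where "s = M p p - (\<Sum>i\<in>I. M p i * w i)"
  have Mw: "(\<Sum>j\<in>I. M i j * w j) = M i p" if "i \<in> I" for i
    using app_inverse[OF B that, of "\<lambda>i. M i p"] by (simp add: w_def app_def)
  have wsum: "(\<Sum>j\<in>I. M p j * B j k) = w k" if "k \<in> I" for k
    unfolding w_def app_def
  proof (intro sum.cong refl)
    fix j assume "j \<in> I"
    then show "M p j * B j k = B k j * M j p"
      using that sym_onD[OF D(3), of j k] sym_onD[OF insert.prems(1), of p j] by simp
  qed
  let ?z = "\<lambda>i. if i = p then 1 else - w i"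
  have app_z: "app (insert p I) M ?z i = M i p - (\<Sum>j\<in>I. M i j * w j)" for i
  proof -
    have "(\<Sum>j\<in>I. M i j * ?z j) = (\<Sum>j\<in>I. - (M i j * w j))"
      using insert.hyps by (intro sum.cong) auto
    then show ?thesis using insert.hyps by (simp add: app_def sum_negf)
  qed
  have "bil (insert p I) M ?z ?z = app (insert p I) M ?z p + (\<Sum>i\<in>I. ?z i * app (insert p I) M ?z i)"
    unfolding bil_def using insert.hyps by simp
  also have "\<dots> = s" unfolding app_z s_def by (simp add: Mw)
  finally have zs: "bil (insert p I) M ?z ?z = s" .
  have "\<exists>i\<in>insert p I. ?z i \<noteq> 0" by auto
  then have "bil (insert p I) M ?z ?z > 0"
    by (rule insert.prems(2)[unfolded pos_def_def, rule_format])
  then have s: "s > 0" unfolding zs .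
  \<comment> \<open>Block inverse: \<open>B\<close> extended by zero, plus \<open>z z^T / s\<close>
    for \<open>z = e_p - w\<close>.\<close>
  define C where "C = (\<lambda>i j. if i = p then (if j = p then 1 / s else - w j / s)
                        else (if j = p then - w i / s else B i j + w i * w j / s))"
  have symC: "sym_on (insert p I) C"
    unfolding sym_on_def
  proof (intro ballI)
    fix i j assume "i \<in> insert p I" "j \<in> insert p I"
    then show "C i j = C j i"
      using sym_onD[OF D(3), of i j] by (cases "i = p"; cases "j = p") (simp_all add: C_def)
  qed
  have "(\<Sum>j\<in>insert p I. M i j * C j k) = (if i = k then 1 else 0)"
    if ik: "i \<in> insert p I" "k \<in> insert p I" for i k
  proof -
    have split: "(\<Sum>j\<in>insert p I. M i j * C j k) = M i p * C p k + (\<Sum>j\<in>I. M i j * C j k)"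
      using insert.hyps by simp
    show ?thesis
    proof (cases "k = p")
      case True
      have "C j k = - w j / s" if "j \<in> I" for j
        using that insert.hyps True by (auto simp: C_def)
      then have "(\<Sum>j\<in>I. M i j * C j k) = (\<Sum>j\<in>I. M i j * w j) * (- 1 / s)"
        unfolding sum_distrib_right by (intro sum.cong refl) simp
      moreover have "C p k = 1 / s" using True by (simp add: C_def)
      ultimately have e: "(\<Sum>j\<in>insert p I. M i j * C j k) = (M i p - (\<Sum>j\<in>I. M i j * w j)) / s"
        unfolding split by (simp add: diff_divide_distrib)
      show ?thesis
      proof (cases "i = p")
        case True
        then show ?thesis using e s \<open>k = p\<close> by (simp add: s_def[symmetric])
      next
        case False
        then show ?thesis using e Mw ik \<open>k = p\<close> by simp
      qed
    next
      case False
      then have k: "k \<in> I" using ik by simp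
      have "C j k = B j k + w j * (w k / s)" if "j \<in> I" for j
        using that insert.hyps False by (auto simp: C_def)
      then have "(\<Sum>j\<in>I. M i j * C j k) = (\<Sum>j\<in>I. M i j * B j k + M i j * w j * (w k / s))"
        by (intro sum.cong refl) (simp add: distrib_left)
      also have "\<dots> = (\<Sum>j\<in>I. M i j * B j k) + (\<Sum>j\<in>I. M i j * w j) * (w k / s)"
        by (simp only: sum.distrib sum_distrib_right[symmetric])
      finally have e1: "(\<Sum>j\<in>I. M i j * C j k) =
        (\<Sum>j\<in>I. M i j * B j k) + (\<Sum>j\<in>I. M i j * w j) * (w k / s)" .
      have "C p k = - w k / s" using False by (simp add: C_def)
      then have e: "(\<Sum>j\<in>insert p I. M i j * C j k) =
          (\<Sum>j\<in>I. M i j * B j k) - (M i p - (\<Sum>j\<in>I. M i j * w j)) * (w k / s)"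
        unfolding split e1 by (simp add: left_diff_distrib diff_divide_distrib)
      show ?thesis
      proof (cases "i = p")
        case True
        then show ?thesis using e s wsum[OF k] False by (simp add: s_def[symmetric])
      next
        case False
        then show ?thesis using e Mw ik D(5) k by simp
      qed
    qed
  qed
  then have "pd_inverse (insert p I) M C"
    unfolding pd_inverse_def using symC insert.hyps(1) insert.prems by blast
  then show ?case by blast
qed

section \<open>Moving the barrier and deleting coordinates\<close>

lemma sum_shift:
  assumes "finite I" "i \<in> I"
  shows "(\<Sum>j\<in>I. shift M b i j * y j) = (\<Sum>j\<in>I. M i j * y j) - b * y i"
proof -
  have "(\<Sum>j\<in>I. shift M b i j * y j) = (\<Sum>j\<in>I. M i j * y j - (if i = j then b * y j else 0))"
    by (intro sum.cong refl) (simp add: shift_def left_diff_distrib)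
  then show ?thesis using assms by (simp add: sum_subtractf)
qed

lemma bil_shift:
  assumes "finite I"
  shows "bil I (shift M b) x y = bil I M x y - b * (\<Sum>i\<in>I. x i * y i)"
proof -
  have "app I (shift M b) y i = app I M y i - b * y i" if "i \<in> I" for i
    using assms that by (simp add: app_def sum_shift)
  then have "bil I (shift M b) x y = (\<Sum>i\<in>I. x i * (app I M y i - b * y i))"
    unfolding bil_def by (intro sum.cong refl) simp
  then show ?thesis by (simp add: bil_def right_diff_distrib sum_subtractf sum_distrib_left mult_ac)
qed

lemma shift_shift: "shift (shift M b) c = shift M (b + c)"
  by (auto simp: shift_def fun_eq_iff)

text \<open>By \<open>pd_inverse_lower_bound\<close> the shift is at most half the least eigenvalue,
  so \<open>M - \<theta>\<close> dominates \<open>M / 2\<close> and the trace of the inverse at most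
  doubles. The finer bound is the resolvent identity \<open>C - B = \<theta> B C\<close> together
  with \<open>tr (B C) \<le> tr (C C)\<close>, whose two sides differ by
  \<open>\<theta> tr (C B C)\<close>. The squares are those of \<open>C\<close>, the inverse after
  the shift, because a deletion is paid for in rows of \<open>C\<close>.\<close>

lemma pd_inverse_shift:
  assumes "pd_inverse I M B" "0 < \<theta>" "\<theta> * trace_on I B \<le> 1 / 2"
  obtains C where "pd_inverse I (shift M \<theta>) C" "trace_on I C \<le> 2 * trace_on I B"
    "trace_on I C \<le> trace_on I B + \<theta> * (\<Sum>i\<in>I. \<Sum>j\<in>I. (C i j)\<^sup>2)"
proof -
  note D = pd_inverseD[OF assms(1)]
  have half: "bil I M x x / 2 \<le> bil I (shift M \<theta>) x x" for x
  proof -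
    have "\<theta> * (\<Sum>i\<in>I. (x i)\<^sup>2) \<le> \<theta> * (trace_on I B * bil I M x x)"
      using pd_inverse_lower_bound[OF assms(1), of x] assms(2) by (intro mult_left_mono) auto
    also have "\<dots> \<le> 1 / 2 * bil I M x x"
      unfolding mult.assoc[symmetric] using assms(3) pos_def_nonneg[OF D(4)] by (intro mult_right_mono)
    finally show ?thesis using D(1) by (simp add: bil_shift power2_eq_square)
  qed
  have "pos_def I (shift M \<theta>)"
    unfolding pos_def_def
  proof (intro allI impI)
    fix x :: "'a \<Rightarrow> real" assume "\<exists>i\<in>I. x i \<noteq> 0"
    then have "0 < bil I M x x" using D(4) by (auto simp: pos_def_def)
    with half[of x] show "0 < bil I (shift M \<theta>) x x" by simp
  qed
  moreover have "sym_on I (shift M \<theta>)" using D(2) by (auto simp: sym_on_def shift_def)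
  ultimately obtain C where C: "pd_inverse I (shift M \<theta>) C"
    using pos_def_inverse_exists D(1) by blast
  note DC = pd_inverseD[OF C]
  \<comment> \<open>Column \<open>k\<close> of \<open>C\<close> has form \<open>C k k\<close> under
    the shifted matrix, hence at most twice that under \<open>M\<close>; Cauchy-Schwarz then bounds
    its entry \<open>k\<close>.\<close>
  have Cd: "C k k \<le> 2 * B k k" if k: "k \<in> I" for k
  proof -
    have pos: "C k k > 0" "B k k > 0" using pd_inverse_diag(2) C assms(1) k by metis+
    have "(C k k)\<^sup>2 \<le> B k k * bil I M (\<lambda>i. C i k) (\<lambda>i. C i k)"
      by (rule pd_inverse_cauchy_schwarz[OF assms(1) k, of "\<lambda>i. C i k"])
    also have "\<dots> \<le> B k k * (2 * C k k)"
      using half[of "\<lambda>i. C i k"] pd_inverse_diag(1)[OF C k] pos by (intro mult_left_mono) auto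
    finally show ?thesis using pos by (simp add: power2_eq_square)
  qed
  have resolvent: "C i k - B i k = \<theta> * (\<Sum>j\<in>I. B i j * C j k)" if ik: "i \<in> I" "k \<in> I" for i k
  proof -
    have "B i k = (\<Sum>j\<in>I. B i j * (if j = k then 1 else 0))"
      using D(1) ik by (simp add: if_distrib cong: if_cong)
    also have "\<dots> = (\<Sum>j\<in>I. B i j * (\<Sum>l\<in>I. shift M \<theta> j l * C l k))"
      using DC(5) ik by (intro sum.cong refl) simp
    also have "\<dots> = (\<Sum>j\<in>I. B i j * ((\<Sum>l\<in>I. M j l * C l k) - \<theta> * C j k))"
      using sum_shift[OF D(1)] by (intro sum.cong refl) simp
    also have "\<dots> = (\<Sum>j\<in>I. \<Sum>l\<in>I. B i j * M j l * C l k) - \<theta> * (\<Sum>j\<in>I. B i j * C j k)"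
      by (simp add: right_diff_distrib sum_subtractf sum_distrib_left mult_ac)
    also have "(\<Sum>j\<in>I. \<Sum>l\<in>I. B i j * M j l * C l k) = (\<Sum>l\<in>I. (\<Sum>j\<in>I. B i j * M j l) * C l k)"
      by (subst sum.swap) (simp add: sum_distrib_right)
    also have "\<dots> = (\<Sum>l\<in>I. if i = l then C l k else 0)"
      using D(6) ik by (intro sum.cong refl) auto
    also have "\<dots> = C i k" using D(1) ik by simp
    finally show ?thesis by simp
  qed
  define tBC where "tBC = (\<Sum>i\<in>I. \<Sum>j\<in>I. B i j * C j i)"
  have tr_diff: "trace_on I C - trace_on I B = \<theta> * tBC"
    unfolding trace_on_def tBC_def sum_subtractf[symmetric] sum_distrib_left[of \<theta>]
    by (intro sum.cong refl) (simp add: resolvent sum_distrib_left)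
  have "(\<Sum>i\<in>I. \<Sum>k\<in>I. (C i k)\<^sup>2) - tBC = (\<Sum>i\<in>I. \<Sum>k\<in>I. (C i k - B i k) * C k i)"
    unfolding tBC_def sum_subtractf[symmetric]
    by (intro sum.cong refl) (simp add: sym_onD[OF DC(3)] power2_eq_square left_diff_distrib)
  also have "\<dots> = (\<Sum>i\<in>I. \<Sum>k\<in>I. \<theta> * (\<Sum>j\<in>I. B i j * C j k) * C k i)"
    by (intro sum.cong refl) (simp add: resolvent)
  also have "\<dots> = (\<Sum>k\<in>I. \<Sum>i\<in>I. \<theta> * (\<Sum>j\<in>I. B i j * C j k) * C k i)"
    by (rule sum.swap)
  also have "\<dots> = \<theta> * (\<Sum>k\<in>I. \<Sum>i\<in>I. (\<Sum>j\<in>I. B i j * C j k) * C k i)"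
    by (simp only: sum_distrib_left[of \<theta>, symmetric] mult.assoc)
  also have "(\<Sum>k\<in>I. \<Sum>i\<in>I. (\<Sum>j\<in>I. B i j * C j k) * C k i) = (\<Sum>k\<in>I. bil I B (\<lambda>i. C i k) (\<lambda>i. C i k))"
    unfolding bil_def app_def
  proof (intro sum.cong refl)
    fix i k assume "k \<in> I" "i \<in> I"
    then show "(\<Sum>j\<in>I. B i j * C j k) * C k i = C i k * (\<Sum>j\<in>I. B i j * C j k)"
      using sym_onD[OF DC(3), of i k] by simp
  qed
  also have "\<theta> * \<dots> \<ge> 0"
    using assms(2) pd_inverse_nonneg[OF assms(1)] by (intro mult_nonneg_nonneg sum_nonneg) auto
  finally have "tBC \<le> (\<Sum>i\<in>I. \<Sum>j\<in>I. (C i j)\<^sup>2)" by simp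
  then have "trace_on I C \<le> trace_on I B + \<theta> * (\<Sum>i\<in>I. \<Sum>j\<in>I. (C i j)\<^sup>2)"
    using tr_diff assms(2) mult_left_mono[of tBC "\<Sum>i\<in>I. \<Sum>j\<in>I. (C i j)\<^sup>2" \<theta>] by linarith
  moreover have "trace_on I C \<le> 2 * trace_on I B"
    unfolding trace_on_def sum_distrib_left using Cd by (intro sum_mono)
  ultimately show thesis using that[OF C] by simp
qed

text \<open>The inverse of a principal submatrix is the Schur complement of \<open>p\<close> in the
  full inverse. It vanishes in row and column \<open>p\<close>, so sums over \<open>I\<close> and
  over \<open>I - {p}\<close> agree.\<close>

lemma pd_inverse_remove:
  assumes "pd_inverse I M B" "p \<in> I"
  defines "C \<equiv> \<lambda>i j. B i j - B i p * B p j / B p p"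
  shows "pd_inverse (I - {p}) M C"
    and "trace_on (I - {p}) C = trace_on I B - (\<Sum>j\<in>I. (B p j)\<^sup>2) / B p p"
proof -
  note D = pd_inverseD[OF assms(1)]
  have bpp: "B p p > 0" using pd_inverse_diag(2)[OF assms(1,2)] .
  have C0: "C p k = 0" for k using bpp by (simp add: C_def)
  have "(\<Sum>j\<in>I - {p}. M i j * C j k) = (if i = k then 1 else 0)" if "i \<in> I - {p}" "k \<in> I - {p}" for i k
  proof -
    have "(\<Sum>j\<in>I - {p}. M i j * C j k) = (\<Sum>j\<in>I. M i j * C j k)"
      using D(1) assms(2) C0 by (simp add: sum.remove[of I p])
    also have "\<dots> = (\<Sum>j\<in>I. M i j * B j k) - (\<Sum>j\<in>I. M i j * B j p) * (B p k / B p p)"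
      unfolding C_def sum_distrib_right sum_subtractf[symmetric]
      by (intro sum.cong refl) (simp add: algebra_simps)
    finally show ?thesis using D(5) that assms(2) by simp
  qed
  moreover have "sym_on (I - {p}) C"
    unfolding sym_on_def
  proof (intro ballI)
    fix i j assume ij: "i \<in> I - {p}" "j \<in> I - {p}"
    then have "B i j = B j i" "B i p = B p i" "B p j = B j p"
      using sym_onD[OF D(3)] assms(2) by blast+
    then show "C i j = C j i" unfolding C_def by simp
  qed
  moreover have "sym_on (I - {p}) M" using D(2) by (simp add: sym_on_def)
  ultimately show "pd_inverse (I - {p}) M C"
    unfolding pd_inverse_def using D(1) pos_def_subset[OF D(4,1), of "I - {p}"] by blast
  have "trace_on (I - {p}) C = (\<Sum>i\<in>I. C i i)"
    unfolding trace_on_def using D(1) assms(2) C0 by (simp add: sum.remove[of I p])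
  also have "\<dots> = trace_on I B - (\<Sum>j\<in>I. (B p j)\<^sup>2) / B p p"
    unfolding trace_on_def C_def sum_divide_distrib sum_subtractf power2_eq_square
    by (intro arg_cong2[where f = minus] sum.cong refl) (simp add: sym_onD[OF D(3) _ assms(2)])
  finally show "trace_on (I - {p}) C = trace_on I B - (\<Sum>j\<in>I. (B p j)\<^sup>2) / B p p" .
qed

text \<open>One step of the barrier argument: moving the barrier from \<open>b\<close> to \<open>b + 1/(2\<Phi>)\<close> raises the
  potential \<open>tr (M - b)\<^sup>-\<^sup>1\<close> by at most what deleting a suitable coordinate regains.\<close>

lemma barrier_step:
  assumes "pd_inverse I M B" "trace_on I B \<le> \<Phi>" "\<Phi> > 0" "I \<noteq> {}"
  obtains p C where "p \<in> I" "pd_inverse (I - {p}) (shift M (1 / (2 * \<Phi>))) C" "trace_on (I - {p}) C \<le> \<Phi>"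
proof -
  define \<theta> where "\<theta> = 1 / (2 * \<Phi>)"
  have \<theta>: "\<theta> > 0" "\<theta> * \<Phi> = 1 / 2" using assms(3) by (auto simp: \<theta>_def)
  have "\<theta> * trace_on I B \<le> 1 / 2"
    using mult_left_mono[OF assms(2), of \<theta>] \<theta> by simp
  then obtain C where C: "pd_inverse I (shift M \<theta>) C" "trace_on I C \<le> 2 * trace_on I B"
    "trace_on I C \<le> trace_on I B + \<theta> * (\<Sum>i\<in>I. \<Sum>j\<in>I. (C i j)\<^sup>2)"
    using pd_inverse_shift[OF assms(1) \<theta>(1)] by blast
  note D = pd_inverseD[OF C(1)]
  define S where "S = (\<Sum>i\<in>I. \<Sum>j\<in>I. (C i j)\<^sup>2)"
  define T where "T = trace_on I C"
  have T: "T > 0" unfolding T_def trace_on_def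
    using pd_inverse_diag(2)[OF C(1)] assms(4) D(1) by (intro sum_pos) auto
  \<comment> \<open>Averaging with weights \<open>C p p\<close>: the ratios of the row sums of
    squares to the diagonal entries have mean \<open>S / T\<close>.\<close>
  have "\<exists>p\<in>I. S / T * C p p \<le> (\<Sum>j\<in>I. (C p j)\<^sup>2)"
  proof (rule ccontr)
    assume "\<not> ?thesis"
    then have "(\<Sum>p\<in>I. (\<Sum>j\<in>I. (C p j)\<^sup>2)) < (\<Sum>p\<in>I. S / T * C p p)"
      using assms(4) D(1) by (intro sum_strict_mono) auto
    also have "\<dots> = S / T * T" unfolding T_def trace_on_def by (rule sum_distrib_left[symmetric])
    also have "\<dots> = S" using T by simp
    finally show False by (simp add: S_def)
  qed
  then obtain p where p: "p \<in> I" "S / T * C p p \<le> (\<Sum>j\<in>I. (C p j)\<^sup>2)" by blast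
  have "S / T \<le> (\<Sum>j\<in>I. (C p j)\<^sup>2) / C p p"
    using p pd_inverse_diag(2)[OF C(1) p(1)] by (simp add: field_simps)
  \<comment> \<open>The shift costs at most \<open>\<theta> * S\<close> and the deletion regains at
    least \<open>S / T\<close>. Since \<open>T\<close> is at most \<open>2 * \<Phi>\<close>, the
    step length \<open>1 / (2 * \<Phi>)\<close> is just short enough.\<close>
  moreover have "\<theta> * S \<le> S / T"
  proof -
    have "\<theta> * T \<le> \<theta> * (2 * \<Phi>)" using C(2) assms(2) \<theta>(1) by (intro mult_left_mono) (auto simp: T_def)
    then have "\<theta> * T \<le> 1" using \<theta>(2) by (simp add: mult.left_commute)
    then have "\<theta> \<le> 1 / T" using T by (simp add: field_simps)
    moreover have "S \<ge> 0" by (auto simp: S_def intro!: sum_nonneg)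
    ultimately show ?thesis using mult_right_mono[of \<theta> "1 / T" S] by simp
  qed
  ultimately have "T - (\<Sum>j\<in>I. (C p j)\<^sup>2) / C p p \<le> \<Phi>"
    using C(3) assms(2) by (simp add: S_def T_def)
  then have "trace_on (I - {p}) (\<lambda>i j. C i j - C i p * C p j / C p p) \<le> \<Phi>"
    unfolding pd_inverse_remove(2)[OF C(1) p(1)] T_def .
  then show thesis
    using that[OF p(1)] pd_inverse_remove(1)[OF C(1) p(1)] unfolding \<theta>_def by blast
qed

text \<open>The potential never exceeds its initial bound, so every deletion moves the barrier by
  the same amount.\<close>

lemma barrier_iterate:
  assumes "pd_inverse I M B" "trace_on I B \<le> \<Phi>" "\<Phi> > 0" "m \<le> card I"
  shows "\<exists>J C. J \<subseteq> I \<and> card J = card I - m \<and> pd_inverse J (shift M (real m / (2 * \<Phi>))) C \<and>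
           trace_on J C \<le> \<Phi>"
  using assms(4)
proof (induction m)
  case 0
  have "shift M 0 = M" by (simp add: shift_def fun_eq_iff)
  then show ?case using assms by auto
next
  case (Suc m)
  then obtain J C where J: "J \<subseteq> I" "card J = card I - m"
    "pd_inverse J (shift M (real m / (2 * \<Phi>))) C" "trace_on J C \<le> \<Phi>" by auto
  have "J \<noteq> {}" using J(2) Suc.prems by auto
  from barrier_step[OF J(3,4) assms(3) this] obtain p C' where p: "p \<in> J"
    "pd_inverse (J - {p}) (shift (shift M (real m / (2 * \<Phi>))) (1 / (2 * \<Phi>))) C'" "trace_on (J - {p}) C' \<le> \<Phi>" .
  have "pd_inverse (J - {p}) (shift M (real (Suc m) / (2 * \<Phi>))) C'"
    using p(2) by (simp add: shift_shift add_divide_distrib add.commute)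
  moreover have "card (J - {p}) = card I - Suc m" using J(2) p(1) pd_inverseD(1)[OF J(3)] by simp
  ultimately show ?case using J(1) p(3)
    by (intro exI[of _ "J - {p}"] exI[of _ C'] conjI) auto
qed

text \<open>Starting at \<open>- \<beta>\<close> costs \<open>\<beta>\<close> at the end, but an
  eigenvalue of \<open>M\<close> close to 0 then contributes only about \<open>1 / \<beta>\<close>
  to the initial potential. From the final position only positive definiteness is kept.\<close>

lemma restricted_invertibility:
  assumes "pd_inverse I (shift M (- \<beta>)) B" "trace_on I B \<le> \<Phi>" "\<Phi> > 0" "m \<le> card I"
  obtains J where "J \<subseteq> I" "card J = card I - m"
    "\<And>x. (real m / (2 * \<Phi>) - \<beta>) * (\<Sum>i\<in>J. (x i)\<^sup>2) \<le> bil J M x x"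
proof -
  obtain J C where J: "J \<subseteq> I" "card J = card I - m"
    "pd_inverse J (shift (shift M (- \<beta>)) (real m / (2 * \<Phi>))) C"
    using barrier_iterate[OF assms] by metis
  have "(real m / (2 * \<Phi>) - \<beta>) * (\<Sum>i\<in>J. (x i)\<^sup>2) \<le> bil J M x x" for x
    using pos_def_nonneg[OF pd_inverseD(4)[OF J(3)], of x] pd_inverseD(1)[OF J(3)]
    by (simp add: shift_shift bil_shift power2_eq_square algebra_simps)
  then show thesis using that[OF J(1,2)] by simp
qed

section \<open>Lebesgue measure on finite products\<close>

abbreviation leb :: "'a set \<Rightarrow> ('a \<Rightarrow> real) measure" where
  "leb I \<equiv> Pi\<^sub>M I (\<lambda>_. lborel)"

text \<open>Points of \<open>leb I\<close> are extensional functions, so sums and linear images have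
  to be restricted to remain in the space.\<close>

definition padd :: "'a set \<Rightarrow> ('a \<Rightarrow> real) \<Rightarrow> ('a \<Rightarrow> real) \<Rightarrow> 'a \<Rightarrow> real" where
  "padd I x a = (\<lambda>i\<in>I. x i + a i)"

definition lin :: "'a set \<Rightarrow> ('a \<Rightarrow> 'a \<Rightarrow> real) \<Rightarrow> ('a \<Rightarrow> real) \<Rightarrow> 'a \<Rightarrow> real" where
  "lin I W x = (\<lambda>i\<in>I. \<Sum>j\<in>I. W i j * x j)"

section \<open>Measurability and translation invariance\<close>

lemma leb_product_sigma_finite: "product_sigma_finite (\<lambda>_. lborel :: real measure)"
  by standard

lemma leb_sigma_finite: "finite I \<Longrightarrow> sigma_finite_measure (leb I)"
  by (rule product_sigma_finite.sigma_finite[OF leb_product_sigma_finite])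

lemma leb_component [measurable (raw)]:
  "f \<in> measurable N (leb I) \<Longrightarrow> i \<in> I \<Longrightarrow> (\<lambda>x. f x i) \<in> borel_measurable N"
  using measurable_compose[OF _ measurable_component_singleton, of f N I "\<lambda>_. lborel :: real measure" i]
  by simp

lemma sets_vimage_Collect:
  assumes "f \<in> measurable M N" "A \<in> sets N"
  shows "{x \<in> space M. f x \<in> A} \<in> sets M"
proof -
  have "{x \<in> space M. f x \<in> A} = f -` A \<inter> space M" by auto
  then show ?thesis using measurable_sets[OF assms] by simp
qed

lemma padd_measurable [measurable]: "(\<lambda>x. padd I x a) \<in> measurable (leb I) (leb I)"
  unfolding padd_def by measurable

lemma padd_pair_measurable [measurable]:
  assumes [measurable]: "f \<in> measurable N (leb I)" "g \<in> measurable N (leb I)"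
  shows "(\<lambda>x. padd I (f x) (g x)) \<in> measurable N (leb I)"
  unfolding padd_def by (intro measurable_restrict) simp

lemma lin_measurable [measurable]: "finite I \<Longrightarrow> lin I W \<in> measurable (leb I) (leb I)"
  unfolding lin_def by measurable

lemma padd_in_space [simp]: "padd I x a \<in> space (leb I)"
  by (auto simp: padd_def space_PiM)

lemma lin_in_space [simp]: "lin I W x \<in> space (leb I)"
  by (auto simp: lin_def space_PiM)

lemma distr_padd:
  assumes "finite I"
  shows "distr (leb I) (leb I) (\<lambda>x. padd I x a) = leb I"
proof (rule product_sigma_finite.PiM_eqI[OF leb_product_sigma_finite assms])
  fix A :: "'a \<Rightarrow> real set" assume A: "\<And>i. i \<in> I \<Longrightarrow> A i \<in> sets lborel"
  have "emeasure (distr (leb I) (leb I) (\<lambda>x. padd I x a)) (Pi\<^sub>E I A) =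
      emeasure (leb I) ((\<lambda>x. padd I x a) -` Pi\<^sub>E I A \<inter> space (leb I))"
    using A assms by (intro emeasure_distr) (auto intro!: sets_PiM_I_finite)
  also have "(\<lambda>x. padd I x a) -` Pi\<^sub>E I A \<inter> space (leb I) = Pi\<^sub>E I (\<lambda>i. (+) (a i) -` A i)"
    by (auto simp: padd_def space_PiM PiE_iff add.commute)
  also have "emeasure (leb I) \<dots> = (\<Prod>i\<in>I. emeasure lborel ((+) (a i) -` A i))"
    using A assms
    by (intro product_sigma_finite.emeasure_PiM[OF leb_product_sigma_finite])
      (auto intro!: measurable_sets_borel[where M = borel])
  also have "\<dots> = (\<Prod>i\<in>I. emeasure lborel (A i))"
  proof (intro prod.cong refl)
    fix i assume "i \<in> I"
    have "emeasure lborel (A i) = emeasure (distr lborel borel ((+) (a i))) (A i)"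
      by (simp add: lborel_distr_plus)
    also have "\<dots> = emeasure lborel ((+) (a i) -` A i)"
      using A[OF \<open>i \<in> I\<close>] by (subst emeasure_distr) auto
    finally show "emeasure lborel ((+) (a i) -` A i) = emeasure lborel (A i)" ..
  qed
  finally show "emeasure (distr (leb I) (leb I) (\<lambda>x. padd I x a)) (Pi\<^sub>E I A) =
      (\<Prod>i\<in>I. emeasure lborel (A i))" .
qed simp

lemma nn_integral_padd:
  assumes "finite I" "f \<in> borel_measurable (leb I)"
  shows "(\<integral>\<^sup>+x. f (padd I x a) \<partial>leb I) = (\<integral>\<^sup>+x. f x \<partial>leb I)"
proof -
  have "(\<integral>\<^sup>+x. f x \<partial>leb I) = (\<integral>\<^sup>+x. f x \<partial>distr (leb I) (leb I) (\<lambda>x. padd I x a))"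
    by (simp only: distr_padd[OF assms(1)])
  also have "\<dots> = (\<integral>\<^sup>+x. f (padd I x a) \<partial>leb I)"
    using assms(2) by (intro nn_integral_distr) auto
  finally show ?thesis ..
qed

lemma emeasure_padd:
  assumes "finite I" "A \<in> sets (leb I)"
  shows "emeasure (leb I) {x \<in> space (leb I). padd I x a \<in> A} = emeasure (leb I) A"
proof -
  have "emeasure (leb I) A = emeasure (distr (leb I) (leb I) (\<lambda>x. padd I x a)) A"
    by (simp only: distr_padd[OF assms(1)])
  also have "\<dots> = emeasure (leb I) ((\<lambda>x. padd I x a) -` A \<inter> space (leb I))"
    using assms(2) by (intro emeasure_distr) auto
  finally show ?thesis by (simp add: vimage_def Int_def conj_commute)
qed

section \<open>How linear maps change volume\<close>

lemma lin_padd: "lin I W (padd I x y) = padd I (lin I W x) (lin I W y)"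
  by (auto simp: lin_def padd_def fun_eq_iff distrib_left sum.distrib)

text \<open>Uniqueness of Haar measure in miniature: computing
  \<open>\<integral>\<integral> 1\<^sub>X(x) 1\<^sub>Y(x + \<phi> y) dx dy\<close> in both orders shows that a linear bijection
  multiplies all volumes by the same factor, without any determinant.\<close>

lemma emeasure_lin_proportional:
  assumes fin: "finite I"
    and inv: "\<And>x. x \<in> space (leb I) \<Longrightarrow> lin I W (lin I V x) = x"
    and X [measurable]: "X \<in> sets (leb I)" and Y [measurable]: "Y \<in> sets (leb I)"
    and sym: "\<And>x. x \<in> X \<Longrightarrow> (\<lambda>i\<in>I. - x i) \<in> X"
  shows "emeasure (leb I) X * emeasure (leb I) {x \<in> space (leb I). lin I W x \<in> Y} =
    emeasure (leb I) Y * emeasure (leb I) {x \<in> space (leb I). lin I W x \<in> X}"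
proof -
  define neg where "neg x = (\<lambda>i\<in>I. - x i)" for x :: "'a \<Rightarrow> real"
  have neg_measurable [measurable]: "neg \<in> measurable (leb I) (leb I)"
    unfolding neg_def by measurable
  note lin_measurable[OF fin, measurable]
  have vol: "emeasure (leb I) {x \<in> space (leb I). lin I W x \<in> Z} = (\<integral>\<^sup>+y. indicator Z (lin I W y) \<partial>leb I)"
    if [measurable]: "Z \<in> sets (leb I)" for Z
  proof -
    have "emeasure (leb I) {x \<in> space (leb I). lin I W x \<in> Z} =
      (\<integral>\<^sup>+y. indicator {x \<in> space (leb I). lin I W x \<in> Z} y \<partial>leb I)"
      by (intro nn_integral_indicator[symmetric]) measurable
    also have "\<dots> = (\<integral>\<^sup>+y. indicator Z (lin I W y) \<partial>leb I)"
      by (intro nn_integral_cong) (auto split: split_indicator)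
    finally show ?thesis .
  qed
  interpret pair_sigma_finite "leb I" "leb I"
    using leb_sigma_finite[OF fin] by (simp add: pair_sigma_finite_def)
  \<comment> \<open>The right inverse absorbs \<open>x\<close>:
    \<open>x + W y = W (y + V x)\<close>, and translating \<open>y\<close> by \<open>V x\<close>
    does not change the integral.\<close>
  have inner1: "(\<integral>\<^sup>+y. indicator X x * indicator Y (padd I x (lin I W y)) \<partial>leb I) =
     indicator X x * emeasure (leb I) {x \<in> space (leb I). lin I W x \<in> Y}"
    if x: "x \<in> space (leb I)" for x
  proof -
    have "padd I x (lin I W y) = lin I W (padd I y (lin I V x))" for y
      by (simp add: lin_padd inv[OF x]) (simp add: padd_def add.commute)
    then have "(\<integral>\<^sup>+y. indicator Y (padd I x (lin I W y)) \<partial>leb I) = 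
       (\<integral>\<^sup>+y. indicator Y (lin I W (padd I y (lin I V x))) \<partial>leb I)" by simp
    also have "\<dots> = (\<integral>\<^sup>+y. indicator Y (lin I W y) \<partial>leb I)"
      by (rule nn_integral_padd[OF fin, of "\<lambda>y. indicator Y (lin I W y)"]) measurable
    finally show ?thesis
      using x by (subst nn_integral_cmult) (auto simp: vol)
  qed
  \<comment> \<open>Translating \<open>x\<close> by \<open>W y\<close> moves the dependence on
    \<open>y\<close> from the indicator of \<open>Y\<close> to that of \<open>X\<close>.\<close>
  have inner2: "(\<integral>\<^sup>+x. indicator X x * indicator Y (padd I x (lin I W y)) \<partial>leb I) =
     (\<integral>\<^sup>+x. indicator X (padd I x (neg (lin I W y))) * indicator Y x \<partial>leb I)"
    (is "_ = (\<integral>\<^sup>+x. ?g x \<partial>leb I)") for y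
  proof -
    have "(\<integral>\<^sup>+x. ?g x \<partial>leb I) = (\<integral>\<^sup>+x. ?g (padd I x (lin I W y)) \<partial>leb I)"
      by (rule nn_integral_padd[OF fin, symmetric]) measurable
    also have "\<dots> = (\<integral>\<^sup>+x. indicator X x * indicator Y (padd I x (lin I W y)) \<partial>leb I)"
    proof (rule nn_integral_cong)
      fix x assume "x \<in> space (leb I)"
      then have "padd I (padd I x (lin I W y)) (neg (lin I W y)) = x"
        by (auto simp: padd_def neg_def fun_eq_iff space_PiM PiE_iff extensional_def)
      then show "?g (padd I x (lin I W y)) = indicator X x * indicator Y (padd I x (lin I W y))" by simp
    qed
    finally show ?thesis ..
  qed
  have neg_X: "neg z \<in> X \<longleftrightarrow> z \<in> X" if "z \<in> space (leb I)" for z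
  proof -
    have "neg (neg z) = z" using that
      by (auto simp: neg_def fun_eq_iff space_PiM PiE_iff extensional_def)
    then show ?thesis using sym[of z] sym[of "neg z"] by (auto simp: neg_def)
  qed
  \<comment> \<open>Symmetry of \<open>X\<close> replaces \<open>x - W y\<close> by
    \<open>W y - x = W (y + V (- x))\<close>, and \<open>x\<close> is absorbed as before.\<close>
  have inner3: "(\<integral>\<^sup>+y. indicator X (padd I x (neg (lin I W y))) * indicator Y x \<partial>leb I) =
     indicator Y x * emeasure (leb I) {x \<in> space (leb I). lin I W x \<in> X}"
    if x: "x \<in> space (leb I)" for x
  proof -
    have "indicator X (padd I x (neg (lin I W y))) = (indicator X (lin I W (padd I y (lin I V (neg x)))) :: ennreal)" for y
    proof -
      have "neg x \<in> space (leb I)" by (simp add: neg_def space_PiM)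
      then have "lin I W (padd I y (lin I V (neg x))) = padd I (lin I W y) (neg x)"
        by (simp add: lin_padd inv)
      also have "\<dots> = neg (padd I x (neg (lin I W y)))"
        by (auto simp: padd_def neg_def fun_eq_iff)
      finally show ?thesis using neg_X[of "padd I x (neg (lin I W y))"] by (auto split: split_indicator)
    qed
    then have "(\<integral>\<^sup>+y. indicator X (padd I x (neg (lin I W y))) \<partial>leb I) =
      (\<integral>\<^sup>+y. indicator X (lin I W (padd I y (lin I V (neg x)))) \<partial>leb I)" by simp
    also have "\<dots> = (\<integral>\<^sup>+y. indicator X (lin I W y) \<partial>leb I)"
      by (rule nn_integral_padd[OF fin, of "\<lambda>y. indicator X (lin I W y)"]) measurable
    finally show ?thesis
      using x by (subst nn_integral_multc) (auto simp: vol mult.commute)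
  qed
  have "emeasure (leb I) X * emeasure (leb I) {x \<in> space (leb I). lin I W x \<in> Y} =
    (\<integral>\<^sup>+x. indicator X x * emeasure (leb I) {x \<in> space (leb I). lin I W x \<in> Y} \<partial>leb I)"
    by (simp add: nn_integral_multc)
  also have "\<dots> = (\<integral>\<^sup>+x. (\<integral>\<^sup>+y. indicator X x * indicator Y (padd I x (lin I W y)) \<partial>leb I) \<partial>leb I)"
    by (intro nn_integral_cong) (simp add: inner1)
  also have "\<dots> = (\<integral>\<^sup>+y. (\<integral>\<^sup>+x. indicator X x * indicator Y (padd I x (lin I W y)) \<partial>leb I) \<partial>leb I)"
    by (rule Fubini') measurable
  also have "\<dots> = (\<integral>\<^sup>+y. (\<integral>\<^sup>+x. indicator X (padd I x (neg (lin I W y))) * indicator Y x \<partial>leb I) \<partial>leb I)"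
    by (simp only: inner2)
  also have "\<dots> = (\<integral>\<^sup>+x. (\<integral>\<^sup>+y. indicator X (padd I x (neg (lin I W y))) * indicator Y x \<partial>leb I) \<partial>leb I)"
    by (rule Fubini') measurable
  also have "\<dots> = (\<integral>\<^sup>+x. indicator Y x * emeasure (leb I) {x \<in> space (leb I). lin I W x \<in> X} \<partial>leb I)"
    by (intro nn_integral_cong) (simp add: inner3)
  also have "\<dots> = emeasure (leb I) Y * emeasure (leb I) {x \<in> space (leb I). lin I W x \<in> X}"
    by (simp add: nn_integral_multc)
  finally show ?thesis .
qed

lemma lin_lin:
  assumes "finite I" "x \<in> space (leb I)"
    and "\<And>i k. i \<in> I \<Longrightarrow> k \<in> I \<Longrightarrow> (\<Sum>j\<in>I. W i j * V j k) = (if i = k then 1 else 0)"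
  shows "lin I W (lin I V x) = x"
proof
  fix i
  show "lin I W (lin I V x) i = x i"
  proof (cases "i \<in> I")
    case True
    have "lin I W (lin I V x) i = (\<Sum>j\<in>I. \<Sum>k\<in>I. W i j * V j k * x k)"
      using True by (simp add: lin_def sum_distrib_left mult.assoc)
    also have "\<dots> = (\<Sum>k\<in>I. (\<Sum>j\<in>I. W i j * V j k) * x k)"
      by (subst sum.swap) (simp add: sum_distrib_right)
    also have "\<dots> = (\<Sum>k\<in>I. if i = k then x k else 0)"
      using True assms(3) by (intro sum.cong refl) auto
    finally show ?thesis using True assms(1) by simp
  next
    case False
    then show ?thesis using assms(2) by (auto simp: lin_def space_PiM PiE_iff extensional_def)
  qed
qed

text \<open>A product of two Euclidean unit balls; \<open>J = {}\<close> gives the unit ball itself.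
  General \<open>J\<close> serves the projection argument, where a body over \<open>J\<close> is
  thickened by a ball over the remaining coordinates.\<close>

definition pball :: "'a set \<Rightarrow> 'a set \<Rightarrow> ('a \<Rightarrow> real) set" where
  "pball I J = {x \<in> space (leb I). (\<Sum>i\<in>J. (x i)\<^sup>2) \<le> 1 \<and> (\<Sum>i\<in>I - J. (x i)\<^sup>2) \<le> 1}"

lemma pball_sets [measurable]:
  assumes "finite I" "J \<subseteq> I"
  shows "pball I J \<in> sets (leb I)"
proof -
  have "(\<lambda>x. (\<Sum>i\<in>K. (x i)\<^sup>2)) \<in> borel_measurable (leb I)" if "K \<subseteq> I" for K
    using that by (intro borel_measurable_sum borel_measurable_power) auto
  note [measurable] = this[OF assms(2)] this[of "I - J", OF Diff_subset]
  show ?thesis unfolding pball_def by measurable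
qed

lemma emeasure_leb_cube:
  assumes "finite I" "\<And>i. i \<in> I \<Longrightarrow> r i \<ge> 0"
  shows "emeasure (leb I) (PiE I (\<lambda>i. {- r i..r i})) = ennreal (\<Prod>i\<in>I. 2 * r i)"
proof -
  have "emeasure (leb I) (PiE I (\<lambda>i. {- r i..r i})) = (\<Prod>i\<in>I. emeasure lborel {- r i..r i})"
    by (intro product_sigma_finite.emeasure_PiM[OF leb_product_sigma_finite] assms) auto
  also have "\<dots> = (\<Prod>i\<in>I. ennreal (2 * r i))"
    using assms by (intro prod.cong refl) auto
  also have "\<dots> = ennreal (\<Prod>i\<in>I. 2 * r i)"
    using assms by (intro prod_ennreal) auto
  finally show ?thesis .
qed

text \<open>Volumes are compared in \<open>ennreal\<close>, where a common factor can be cancelled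
  only if it is neither zero nor infinite. A small cube inside and the unit cube outside show
  this.\<close>

lemma pball_pos_finite:
  assumes "finite I" "J \<subseteq> I"
  shows "0 < emeasure (leb I) (pball I J)" "emeasure (leb I) (pball I J) < \<infinity>"
proof -
  \<comment> \<open>With \<open>r^2 \<le> r\<close>, the squares of all coordinates add up to at
    most \<open>card I * r\<close>, which is below 1; the \<open>+ 1\<close> covers empty
    \<open>I\<close>.\<close>
  define r where "r = 1 / (real (card I) + 1)"
  have r: "r > 0" "r \<le> 1" "real (card I) * r \<le> 1" by (auto simp: r_def field_simps)
  have small: "(\<Sum>i\<in>K. (x i)\<^sup>2) \<le> 1" if "K \<subseteq> I" "x \<in> PiE I (\<lambda>i. {- r..r})" for K x
  proof -
    have "(\<Sum>i\<in>K. (x i)\<^sup>2) \<le> (\<Sum>i\<in>I. (x i)\<^sup>2)"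
      using that assms by (intro sum_mono2) auto
    also have "\<dots> \<le> (\<Sum>i\<in>I. r)"
    proof (intro sum_mono)
      fix i assume "i \<in> I"
      then have "\<bar>x i\<bar> \<le> r" using that by (auto simp: PiE_iff abs_le_iff)
      then have "(x i)\<^sup>2 \<le> r\<^sup>2" using abs_le_square_iff[of "x i" r] r by simp
      also have "\<dots> \<le> r" using r by (simp add: power2_eq_square mult_left_le)
      finally show "(x i)\<^sup>2 \<le> r" .
    qed
    also have "\<dots> \<le> 1" using r by simp
    finally show ?thesis .
  qed
  have "PiE I (\<lambda>i. {- r..r}) \<subseteq> pball I J"
    using small assms(2) by (auto simp: pball_def space_PiM PiE_iff)
  then have "emeasure (leb I) (PiE I (\<lambda>i. {- r..r})) \<le> emeasure (leb I) (pball I J)"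
    using assms by (intro emeasure_mono) auto
  moreover have "0 < emeasure (leb I) (PiE I (\<lambda>i. {- r..r}))"
    using r by (subst emeasure_leb_cube[OF assms(1), of "\<lambda>_. r"]) (auto simp: ennreal_zero_less_one)
  ultimately show "0 < emeasure (leb I) (pball I J)" by (rule less_le_trans[rotated])
  have "pball I J \<subseteq> PiE I (\<lambda>i. {- 1..1})"
  proof
    fix x assume x: "x \<in> pball I J"
    have "\<bar>x i\<bar> \<le> 1" if "i \<in> I" for i
    proof -
      have "(x i)\<^sup>2 \<le> 1"
      proof (cases "i \<in> J")
        case True
        then have "(x i)\<^sup>2 \<le> (\<Sum>i\<in>J. (x i)\<^sup>2)"
          using assms by (intro member_le_sum) (auto intro: finite_subset)
        then show ?thesis using x by (simp add: pball_def)
      next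
        case False
        then have "(x i)\<^sup>2 \<le> (\<Sum>i\<in>I-J. (x i)\<^sup>2)"
          using assms that by (intro member_le_sum) auto
        then show ?thesis using x by (simp add: pball_def)
      qed
      then show ?thesis by (simp add: abs_square_le_1)
    qed
    then show "x \<in> PiE I (\<lambda>i. {- 1..1})"
      using x by (force simp: pball_def space_PiM PiE_iff abs_le_iff)
  qed
  then have "emeasure (leb I) (pball I J) \<le> emeasure (leb I) (PiE I (\<lambda>i. {- 1..1}))"
    using assms by (intro emeasure_mono) (auto intro!: sets_PiM_I_finite)
  also have "\<dots> < \<infinity>"
    by (subst emeasure_leb_cube[OF assms(1), of "\<lambda>_. 1"]) auto
  finally show "emeasure (leb I) (pball I J) < \<infinity>" .
qed

text \<open>The yardstick for \<open>emeasure_lin_proportional\<close> is the unit ball, which an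
  orthogonal map preserves, so the common factor is 1.\<close>

lemma emeasure_orthogonal:
  assumes "finite I" "Y \<in> sets (leb I)"
    and row: "\<And>i k. i \<in> I \<Longrightarrow> k \<in> I \<Longrightarrow> (\<Sum>j\<in>I. W i j * W k j) = (if i = k then 1 else 0)"
    and col: "\<And>i k. i \<in> I \<Longrightarrow> k \<in> I \<Longrightarrow> (\<Sum>j\<in>I. W j i * W j k) = (if i = k then 1 else 0)"
  shows "emeasure (leb I) {x \<in> space (leb I). lin I W x \<in> Y} = emeasure (leb I) Y"
proof -
  have norm: "(\<Sum>i\<in>I. (lin I W x i)\<^sup>2) = (\<Sum>i\<in>I. (x i)\<^sup>2)" if "x \<in> space (leb I)" for x
  proof -
    have "(\<Sum>i\<in>I. (lin I W x i)\<^sup>2) = (\<Sum>i\<in>I. \<Sum>j\<in>I. x j * (W i j * lin I W x i))"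
      by (simp add: lin_def power2_eq_square sum_distrib_right mult_ac)
    also have "\<dots> = (\<Sum>j\<in>I. \<Sum>i\<in>I. x j * (W i j * lin I W x i))"
      by (rule sum.swap)
    also have "\<dots> = (\<Sum>j\<in>I. x j * lin I (\<lambda>i j. W j i) (lin I W x) j)"
      by (simp add: lin_def sum_distrib_left)
    also have "lin I (\<lambda>i j. W j i) (lin I W x) = x"
      by (rule lin_lin[OF assms(1) that]) (rule col)
    finally show ?thesis by (simp add: power2_eq_square)
  qed
  have "emeasure (leb I) (pball I {}) * emeasure (leb I) {x \<in> space (leb I). lin I W x \<in> Y} =
    emeasure (leb I) Y * emeasure (leb I) {x \<in> space (leb I). lin I W x \<in> pball I {}}"
    by (rule emeasure_lin_proportional[where V = "\<lambda>i j. W j i"])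
      (auto simp: assms(1,2) row intro!: lin_lin, auto simp: pball_def space_PiM)
  also have "{x \<in> space (leb I). lin I W x \<in> pball I {}} = pball I {}"
    using norm by (auto simp: pball_def)
  finally show ?thesis
    using pball_pos_finite[OF assms(1), of "{}"]
    by (auto simp: mult.commute[of "emeasure (leb I) Y"] ennreal_mult_cancel_left)
qed

text \<open>Here the yardstick is the cube, because its preimage is a box of explicit
  volume.\<close>

lemma emeasure_scale:
  assumes "finite I" "Y \<in> sets (leb I)" and a: "\<And>i. i \<in> I \<Longrightarrow> a i > 0"
  shows "emeasure (leb I) {x \<in> space (leb I). (\<lambda>i\<in>I. x i / a i) \<in> Y} =
    ennreal (\<Prod>i\<in>I. a i) * emeasure (leb I) Y"
proof -
  define W where "W = (\<lambda>i j. if i = j then 1 / a i else 0)"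
  define V where "V = (\<lambda>i j. if i = j then a i else 0)"
  define Q :: "('a \<Rightarrow> real) set" where "Q = PiE I (\<lambda>i. {- 1..1})"
  have lin_W: "lin I W x = (\<lambda>i\<in>I. x i / a i)" for x
  proof
    fix i
    have "(\<Sum>j\<in>I. W i j * x j) = (\<Sum>j\<in>I. if i = j then x j / a j else 0)"
      by (intro sum.cong refl) (auto simp: W_def)
    then show "lin I W x i = (\<lambda>i\<in>I. x i / a i) i" using assms(1) by (auto simp: lin_def)
  qed
  have WV: "(\<Sum>j\<in>I. W i j * V j k) = (if i = k then 1 else 0)" if "i \<in> I" "k \<in> I" for i k
  proof -
    have "(\<Sum>j\<in>I. W i j * V j k) = (\<Sum>j\<in>I. if i = j then (if i = k then 1 else 0) else 0)"
      using a[OF that(1)] by (intro sum.cong refl) (auto simp: W_def V_def)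
    then show ?thesis using assms(1) that by simp
  qed
  have "emeasure (leb I) Q * emeasure (leb I) {x \<in> space (leb I). lin I W x \<in> Y} =
    emeasure (leb I) Y * emeasure (leb I) {x \<in> space (leb I). lin I W x \<in> Q}"
  proof (rule emeasure_lin_proportional[where V = V, OF assms(1) _ _ assms(2)])
    show "lin I W (lin I V x) = x" if "x \<in> space (leb I)" for x
      by (rule lin_lin[OF assms(1) that WV])
    show "Q \<in> sets (leb I)" unfolding Q_def using assms(1) by (intro sets_PiM_I_finite) auto
    show "(\<lambda>i\<in>I. - x i) \<in> Q" if "x \<in> Q" for x
      using that by (auto simp: Q_def PiE_iff)
  qed
  also have "{x \<in> space (leb I). lin I W x \<in> Q} = PiE I (\<lambda>i. {- a i..a i})"
    using a by (auto simp: lin_W Q_def space_PiM PiE_iff field_simps extensional_def)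
  also have "emeasure (leb I) \<dots> = ennreal (\<Prod>i\<in>I. 2 * a i)"
    using a by (intro emeasure_leb_cube assms(1)) (simp add: less_imp_le)
  also have "(\<Prod>i\<in>I. 2 * a i) = 2 ^ card I * (\<Prod>i\<in>I. a i)" by (simp add: prod.distrib)
  also have "ennreal \<dots> = ennreal (2 ^ card I) * ennreal (\<Prod>i\<in>I. a i)"
    using a by (intro ennreal_mult) (auto intro!: prod_nonneg simp: less_imp_le)
  also have "emeasure (leb I) Q = ennreal (2 ^ card I)"
    using emeasure_leb_cube[OF assms(1), of "\<lambda>_. 1"] by (simp add: Q_def)
  finally have "ennreal (2 ^ card I) * emeasure (leb I) {x \<in> space (leb I). lin I W x \<in> Y} =
    ennreal (2 ^ card I) * (ennreal (\<Prod>i\<in>I. a i) * emeasure (leb I) Y)" by (simp add: mult_ac)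
  then show ?thesis by (subst (asm) ennreal_mult_cancel_left) (auto simp: lin_W)
qed

section \<open>Singular vectors\<close>

definition ip :: "nat \<Rightarrow> (nat \<Rightarrow> real) \<Rightarrow> (nat \<Rightarrow> real) \<Rightarrow> real" where
  "ip n x y = (\<Sum>i<n. x i * y i)"

definition mv :: "nat \<Rightarrow> (nat \<Rightarrow> nat \<Rightarrow> real) \<Rightarrow> (nat \<Rightarrow> real) \<Rightarrow> nat \<Rightarrow> real" where
  "mv n A x i = (\<Sum>j<n. A i j * x j)"

definition orthonormal :: "nat \<Rightarrow> nat \<Rightarrow> (nat \<Rightarrow> nat \<Rightarrow> real) \<Rightarrow> bool" where
  "orthonormal n m v \<longleftrightarrow> (\<forall>k<m. \<forall>l<m. ip n (v k) (v l) = (if k = l then 1 else 0))"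

lemma ip_commute: "ip n x y = ip n y x"
  by (simp add: ip_def mult.commute)

lemma ip_add_left: "ip n (\<lambda>i. x i + y i) z = ip n x z + ip n y z"
  and ip_scale_left: "ip n (\<lambda>i. t * x i) z = t * ip n x z"
  and ip_diff_left: "ip n (\<lambda>i. x i - y i) z = ip n x z - ip n y z"
  and ip_sum_left: "ip n (\<lambda>i. \<Sum>k\<in>K. f k i) z = (\<Sum>k\<in>K. ip n (f k) z)"
  by (simp_all add: ip_def algebra_simps sum.distrib sum_subtractf sum_distrib_left)
    (simp add: sum_distrib_left sum.swap[of _ K])

lemma ip_add_right: "ip n z (\<lambda>i. x i + y i) = ip n z x + ip n z y"
  and ip_scale_right: "ip n z (\<lambda>i. t * x i) = t * ip n z x"
  by (simp_all add: ip_def algebra_simps sum.distrib sum_distrib_left)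

lemma ip_cong: "(\<And>i. i < n \<Longrightarrow> x i = x' i) \<Longrightarrow> (\<And>i. i < n \<Longrightarrow> y i = y' i) \<Longrightarrow> ip n x y = ip n x' y'"
  by (simp add: ip_def)

lemma ip_self_nonneg: "ip n x x \<ge> 0"
  by (simp add: ip_def sum_nonneg)

lemma ip_self_pos: "i < n \<Longrightarrow> x i \<noteq> 0 \<Longrightarrow> ip n x x > 0"
  unfolding ip_def by (rule sum_pos2[where i = i]) (auto simp: zero_less_mult_iff linorder_neq_iff)

lemma ip_unit: "i < n \<Longrightarrow> ip n (\<lambda>j. if j = i then 1 else 0) x = x i"
  by (simp add: ip_def if_distrib[of "\<lambda>t. t * _"] cong: if_cong)

lemma mv_add: "mv n A (\<lambda>i. x i + y i) = (\<lambda>i. mv n A x i + mv n A y i)"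
  and mv_scale: "mv n A (\<lambda>i. t * x i) = (\<lambda>i. t * mv n A x i)"
  by (simp_all add: mv_def fun_eq_iff distrib_left sum.distrib sum_distrib_left mult_ac)

lemma mv_cong: "(\<And>i. i < n \<Longrightarrow> x i = y i) \<Longrightarrow> mv n A x = mv n A y"
  by (simp add: mv_def fun_eq_iff)

lemma compact_box_zero: "compact {x::nat \<Rightarrow> real. (\<forall>i<n. \<bar>x i\<bar> \<le> 1) \<and> (\<forall>i\<ge>n. x i = 0)}"
proof -
  have "compactin (product_topology (\<lambda>_. euclidean) UNIV) (PiE UNIV (\<lambda>i. if i < n then {-1..1::real} else {0}))"
    by (subst compactin_PiE) auto
  then have "compact (PiE UNIV (\<lambda>i. if i < n then {-1..1::real} else {0}))"
    by (simp add: euclidean_product_topology)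
  also have "PiE UNIV (\<lambda>i. if i < n then {-1..1::real} else {0}) =
    {x. (\<forall>i<n. \<bar>x i\<bar> \<le> 1) \<and> (\<forall>i\<ge>n. x i = 0)}"
    by (auto simp: PiE_iff abs_le_iff split: if_splits)
  finally show ?thesis .
qed

lemma continuous_on_coordinate [continuous_intros]: "continuous_on S (\<lambda>x::nat \<Rightarrow> real. x i)"
  by (rule continuous_on_subset[OF continuous_on_product_coordinates]) simp

lemma continuous_on_ip: "continuous_on S (\<lambda>x. ip n x y)"
  and continuous_on_ip_self: "continuous_on S (\<lambda>x. ip n x x)"
  unfolding ip_def by (rule continuous_intros | assumption)+

text \<open>Project the standard unit vectors onto the orthogonal complement. The squared lengths of
  the projections add up to \<open>n - m\<close>, the trace of that projection, so one of them is
  nonzero and can be normalised.\<close>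

lemma exists_orthogonal_unit:
  assumes "orthonormal n m v" "m < n"
  obtains z where "ip n z z = 1" "\<And>j. j < m \<Longrightarrow> ip n z (v j) = 0"
proof -
  define r where "r i = (\<lambda>p. (if p = i then 1 else 0) - (\<Sum>j<m. v j i * v j p))" for i
  have orth: "ip n (r i) (v l) = 0" if "i < n" "l < m" for i l
  proof -
    have "ip n (r i) (v l) = v l i - (\<Sum>j<m. v j i * ip n (v j) (v l))"
      using that by (simp add: r_def ip_diff_left ip_sum_left ip_scale_left ip_unit)
    also have "(\<Sum>j<m. v j i * ip n (v j) (v l)) = (\<Sum>j<m. if j = l then v j i else 0)"
      using assms(1) that by (intro sum.cong refl) (auto simp: orthonormal_def)
    finally show ?thesis using that by simp
  qed
  have "ip n (r i) (r i) = 1 - (\<Sum>j<m. (v j i)\<^sup>2)" if "i < n" for i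
  proof -
    have "ip n (r i) (r i) = r i i - (\<Sum>j<m. v j i * ip n (v j) (r i))"
      using that by (subst (1) r_def) (simp add: ip_diff_left ip_sum_left ip_scale_left ip_unit)
    also have "(\<Sum>j<m. v j i * ip n (v j) (r i)) = 0"
      using orth[OF that] by (intro sum.neutral) (simp add: ip_commute)
    finally show ?thesis by (simp add: r_def power2_eq_square)
  qed
  then have "(\<Sum>i<n. ip n (r i) (r i)) = real n - (\<Sum>i<n. \<Sum>j<m. (v j i)\<^sup>2)"
    by (simp add: sum_subtractf)
  also have "(\<Sum>i<n. \<Sum>j<m. (v j i)\<^sup>2) = (\<Sum>j<m. ip n (v j) (v j))"
    by (subst sum.swap) (simp add: ip_def power2_eq_square)
  also have "\<dots> = real m" using assms(1) by (simp add: orthonormal_def)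
  finally have "(\<Sum>i<n. ip n (r i) (r i)) > 0" using assms(2) by simp
  then have "\<exists>i\<in>{..<n}. \<not> ip n (r i) (r i) \<le> 0"
    using sum_nonpos[of "{..<n}" "\<lambda>i. ip n (r i) (r i)"] by (rule_tac ccontr) auto
  then obtain i where i: "i < n" "ip n (r i) (r i) > 0" by auto
  define s where "s = 1 / sqrt (ip n (r i) (r i))"
  show thesis
  proof
    show "ip n (\<lambda>p. s * r i p) (\<lambda>p. s * r i p) = 1"
    proof -
      have "s * (s * ip n (r i) (r i)) = 1" using i by (simp add: s_def)
      then show ?thesis by (simp only: ip_scale_left ip_scale_right)
    qed
    show "ip n (\<lambda>p. s * r i p) (v j) = 0" if "j < m" for j
      using orth[OF i(1) that] by (simp add: ip_scale_left)
  qed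
qed

text \<open>The first-order condition at a maximum without derivatives: for small \<open>t\<close> a
  nonzero linear term beats the quadratic one.\<close>

lemma linear_le_quadratic_imp_zero:
  assumes "\<And>t::real. 2 * t * c \<le> t\<^sup>2 * d"
  shows "c = 0"
proof (rule ccontr)
  assume c: "c \<noteq> 0"
  \<comment> \<open>\<open>d\<close> may be zero or negative, so a positive number above it takes
    its place in the choice \<open>t = c / D\<close>.\<close>
  define D where "D = \<bar>d\<bar> + 1"
  have D: "D > 0" "d < D" by (auto simp: D_def)
  have "2 * (c / D) * c \<le> (c / D)\<^sup>2 * d" by (rule assms)
  also have "\<dots> \<le> (c / D)\<^sup>2 * D" using D by (intro mult_left_mono) auto
  finally have "2 * c\<^sup>2 \<le> c\<^sup>2" using D by (simp add: power2_eq_square field_simps)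
  then show False using c by simp
qed

text \<open>Singular vectors are found greedily: \<open>v\<^sub>k\<close> maximises \<open>\<bar>A v\<bar>\<close> on the unit sphere of the orthogonal
  complement of the previous ones, and criticality makes \<open>A v\<^sub>k\<close> orthogonal to the image of what is left.\<close>

lemma singular_vectors_aux:
  assumes "m \<le> n"
  shows "\<exists>v. orthonormal n m v \<and>
    (\<forall>k<m. \<forall>w. (\<forall>j\<le>k. ip n w (v j) = 0) \<longrightarrow> ip n (mv n A (v k)) (mv n A w) = 0)"
  using assms
proof (induction m)
  case 0
  then show ?case by (simp add: orthonormal_def)
next
  case (Suc m)
  then obtain v where v: "orthonormal n m v"
    and vA: "\<And>k w. k < m \<Longrightarrow> (\<And>j. j \<le> k \<Longrightarrow> ip n w (v j) = 0) \<Longrightarrow> ip n (mv n A (v k)) (mv n A w) = 0"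
    by auto
  define f where "f x = ip n (mv n A x) (mv n A x)" for x
  \<comment> \<open>Vectors are functions on all of \<open>nat\<close>; fixing the entries from
    \<open>n\<close> on at 0 is what makes this set compact in the product topology.\<close>
  define S where "S = {x. (\<forall>i<n. \<bar>x i\<bar> \<le> 1) \<and> (\<forall>i\<ge>n. x i = 0)} \<inter> {x. ip n x x = 1} \<inter>
    (\<Inter>j\<in>{..<m}. {x. ip n x (v j) = 0})"
  have "compact S" unfolding S_def
    by (intro compact_Int_closed compact_box_zero closed_INT ballI closed_Collect_eq
        continuous_on_ip continuous_on_ip_self continuous_on_const)
  moreover have memS: "x \<in> S" if "ip n x x = 1" "\<And>j. j < m \<Longrightarrow> ip n x (v j) = 0" "\<And>i. i \<ge> n \<Longrightarrow> x i = 0" for x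
  proof -
    have "\<bar>x i\<bar> \<le> 1" if "i < n" for i
    proof -
      have "x i * x i \<le> ip n x x" unfolding ip_def using that by (intro member_le_sum) auto
      then show ?thesis using \<open>ip n x x = 1\<close> by (simp add: power2_eq_square[symmetric] abs_square_le_1)
    qed
    then show ?thesis using that by (auto simp: S_def)
  qed
  moreover have "S \<noteq> {}"
  proof -
    obtain z where z: "ip n z z = 1" "\<And>j. j < m \<Longrightarrow> ip n z (v j) = 0"
      using exists_orthogonal_unit[OF v] Suc.prems by auto
    let ?z = "\<lambda>i. if i < n then z i else 0"
    have "ip n ?z ?z = ip n z z" "ip n ?z w = ip n z w" for w
      by (rule ip_cong; simp)+
    then have "?z \<in> S" using z by (intro memS) auto
    then show ?thesis by auto
  qed
  moreover have "continuous_on S f"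
    unfolding f_def mv_def ip_def by (rule continuous_intros | assumption)+
  ultimately obtain x where x: "x \<in> S" "\<And>y. y \<in> S \<Longrightarrow> f y \<le> f x"
    using continuous_attains_sup[of S f] by auto
  have xx: "ip n x x = 1" "\<And>j. j < m \<Longrightarrow> ip n x (v j) = 0" using x(1) by (auto simp: S_def)
  \<comment> \<open>Maximality on the sphere in homogeneous form, so that the perturbation
    \<open>x + t w\<close> can be inserted without normalising it.\<close>
  have hom: "f y \<le> f x * ip n y y" if "\<And>j. j < m \<Longrightarrow> ip n y (v j) = 0" "ip n y y > 0" for y
  proof -
    define s where "s = 1 / sqrt (ip n y y)"
    have s2: "s * (s * ip n y y) = 1" using that(2) by (simp add: s_def)
    define y' where "y' = (\<lambda>i. if i < n then s * y i else 0)"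
    have ip': "ip n y' z = s * ip n y z" "ip n z y' = s * ip n y z" for z
    proof -
      show "ip n y' z = s * ip n y z"
        unfolding ip_scale_left[symmetric] by (rule ip_cong) (auto simp: y'_def)
      then show "ip n z y' = s * ip n y z" by (simp only: ip_commute[of n z])
    qed
    have "y' \<in> S"
    proof (rule memS)
      show "ip n y' y' = 1" using s2 by (simp add: ip')
      show "ip n y' (v j) = 0" if "j < m" for j using \<open>\<And>j. j < m \<Longrightarrow> ip n y (v j) = 0\<close>[OF that] by (simp add: ip')
      show "y' i = 0" if "i \<ge> n" for i using that by (simp add: y'_def)
    qed
    then have "f y' \<le> f x" by (rule x(2))
    moreover have "mv n A y' = (\<lambda>i. s * mv n A y i)"
      unfolding mv_scale[symmetric] by (rule mv_cong) (simp add: y'_def)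
    then have "f y' = s * (s * f y)" by (simp add: f_def ip_scale_left ip_scale_right)
    ultimately have "(s * (s * f y)) * ip n y y \<le> f x * ip n y y"
      using that(2) by (intro mult_right_mono) auto
    moreover have "(s * (s * f y)) * ip n y y = s * (s * ip n y y) * f y" by simp
    ultimately show ?thesis using s2 by simp
  qed
  have crit: "ip n (mv n A x) (mv n A w) = 0" if w: "\<And>j. j < m \<Longrightarrow> ip n w (v j) = 0" "ip n w x = 0" for w
  proof (rule linear_le_quadratic_imp_zero)
    fix t :: real
    let ?y = "\<lambda>i. x i + t * w i"
    have yy: "ip n ?y ?y = 1 + t\<^sup>2 * ip n w w"
      using xx(1) w(2) by (simp add: ip_add_left ip_add_right ip_scale_left ip_scale_right
          ip_commute[of n x w] power2_eq_square)
    have "f ?y \<le> f x * ip n ?y ?y"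
    proof (rule hom)
      show "ip n ?y (v j) = 0" if "j < m" for j
        using xx(2)[OF that] w(1)[OF that] by (simp add: ip_add_left ip_scale_left)
      show "0 < ip n ?y ?y"
        unfolding yy using ip_self_nonneg[of n w] by (intro add_pos_nonneg) auto
    qed
    moreover have "f ?y = f x + 2 * t * ip n (mv n A x) (mv n A w) + t\<^sup>2 * f w"
      by (simp add: f_def mv_add mv_scale ip_add_left ip_add_right ip_scale_left ip_scale_right
          ip_commute[of n "mv n A w" "mv n A x"] power2_eq_square)
    ultimately show "2 * t * ip n (mv n A x) (mv n A w) \<le> t\<^sup>2 * (f x * ip n w w - f w)"
      by (simp add: yy algebra_simps)
  qed
  define v' where "v' = v(m := x)"
  have "orthonormal n (Suc m) v'"
    using v xx by (auto simp: orthonormal_def v'_def less_Suc_eq ip_commute[of n "v _" x])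
  moreover have "ip n (mv n A (v' k)) (mv n A w) = 0"
    if "k < Suc m" "\<And>j. j \<le> k \<Longrightarrow> ip n w (v' j) = 0" for k w
  proof (cases "k = m")
    case True
    have "ip n w (v j) = 0" if "j < m" for j
      using \<open>\<And>j. j \<le> k \<Longrightarrow> ip n w (v' j) = 0\<close>[of j] that True by (simp add: v'_def)
    moreover have "ip n w x = 0" using that(2)[of m] True by (simp add: v'_def)
    ultimately show ?thesis using crit True by (simp add: v'_def)
  next
    case False
    have "ip n w (v j) = 0" if "j \<le> k" for j
      using \<open>\<And>j. j \<le> k \<Longrightarrow> ip n w (v' j) = 0\<close>[of j] that False \<open>k < Suc m\<close> by (auto simp: v'_def split: if_splits)
    then show ?thesis using vA[of k w] False \<open>k < Suc m\<close> by (simp add: v'_def)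
  qed
  ultimately show ?case by blast
qed

lemma singular_vectors:
  obtains v where "orthonormal n n v"
    "\<And>k l. k < n \<Longrightarrow> l < n \<Longrightarrow> k \<noteq> l \<Longrightarrow> ip n (mv n A (v k)) (mv n A (v l)) = 0"
proof -
  obtain v where v: "orthonormal n n v"
    and vA: "\<And>k w. k < n \<Longrightarrow> (\<And>j. j \<le> k \<Longrightarrow> ip n w (v j) = 0) \<Longrightarrow> ip n (mv n A (v k)) (mv n A w) = 0"
    using singular_vectors_aux[of n n A] by auto
  have less: "ip n (mv n A (v k)) (mv n A (v l)) = 0" if "k < l" "l < n" for k l
    using that v by (intro vA) (auto simp: orthonormal_def)
  show thesis
  proof (rule that[OF v])
    fix k l assume "k < n" "l < n" "k \<noteq> l"
    then show "ip n (mv n A (v k)) (mv n A (v l)) = 0"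
      using less[of k l] less[of l k] by (cases "k < l") (auto simp: ip_commute)
  qed
qed

text \<open>A one-sided inverse of a square matrix is two-sided. For the matrix with rows
  \<open>v k\<close> this is completeness of the family, from which expansion and Parseval
  follow.\<close>

lemma orthonormal_columns:
  assumes "orthonormal n n v" "i < n" "j < n"
  shows "(\<Sum>k<n. v k i * v k j) = (if i = j then 1 else 0)"
proof -
  define V where "V = mat n n (\<lambda>(k, i). v k i)"
  have V: "V \<in> carrier_mat n n" "V\<^sup>T \<in> carrier_mat n n" by (auto simp: V_def)
  have "V * V\<^sup>T = 1\<^sub>m n"
    using assms(1) by (intro eq_matI) (auto simp: V_def scalar_prod_def orthonormal_def ip_def lessThan_atLeast0)
  then have "V\<^sup>T * V = 1\<^sub>m n" using V by (rule mat_mult_left_right_inverse[rotated 2])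
  then have "(V\<^sup>T * V) $$ (i, j) = (if i = j then 1 else 0)" using assms by simp
  then show ?thesis using assms by (simp add: V_def scalar_prod_def lessThan_atLeast0)
qed

lemma orthonormal_expand:
  assumes "orthonormal n n v" "i < n"
  shows "x i = (\<Sum>k<n. ip n x (v k) * v k i)"
proof -
  have "(\<Sum>k<n. ip n x (v k) * v k i) = (\<Sum>j<n. \<Sum>k<n. x j * (v k j * v k i))"
    by (subst sum.swap) (simp add: ip_def sum_distrib_right mult.assoc)
  also have "\<dots> = (\<Sum>j<n. if j = i then x j else 0)"
    using orthonormal_columns[OF assms(1) _ assms(2)] 
    by (intro sum.cong refl) (auto simp: sum_distrib_left[symmetric])
  finally show ?thesis using assms(2) by simp
qed

lemma orthonormal_parseval:
  assumes "orthonormal n n v"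
  shows "ip n x y = (\<Sum>k<n. ip n x (v k) * ip n y (v k))"
proof -
  have "ip n x y = ip n (\<lambda>i. \<Sum>k<n. ip n x (v k) * v k i) y"
    using orthonormal_expand[OF assms] by (intro ip_cong) auto
  then show ?thesis by (simp add: ip_sum_left ip_scale_left ip_commute)
qed

section \<open>Principal axes of ellipsoids\<close>

text \<open>The squared gauge of the ellipsoid with semi-axes \<open>a k\<close> in the directions
  \<open>u k\<close>.\<close>

definition axis_form :: "nat \<Rightarrow> (nat \<Rightarrow> nat \<Rightarrow> real) \<Rightarrow> (nat \<Rightarrow> real) \<Rightarrow> real vec \<Rightarrow> real" where
  "axis_form n u a x = (\<Sum>k<n. (ip n (vec_index x) (u k) / a k)\<^sup>2)"

definition has_axes :: "nat \<Rightarrow> (nat \<Rightarrow> nat \<Rightarrow> real) \<Rightarrow> (nat \<Rightarrow> real) \<Rightarrow> real vec set \<Rightarrow> bool" where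
  "has_axes n u a E \<longleftrightarrow> orthonormal n n u \<and> (\<forall>k<n. a k > 0) \<and>
     E = {x \<in> carrier_vec n. axis_form n u a x \<le> 1}"

definition from_axes :: "nat \<Rightarrow> (nat \<Rightarrow> nat \<Rightarrow> real) \<Rightarrow> (nat \<Rightarrow> real) \<Rightarrow> real vec" where
  "from_axes n u c = vec n (\<lambda>i. \<Sum>k<n. c k * u k i)"

lemma scalar_prod_ip: "y \<in> carrier_vec n \<Longrightarrow> x \<bullet> y = ip n (vec_index x) (vec_index y)"
  by (simp add: scalar_prod_def ip_def lessThan_atLeast0)

lemma from_axes_carrier [simp]: "from_axes n u c \<in> carrier_vec n"
  by (simp add: from_axes_def)

lemma ip_from_axes:
  assumes "orthonormal n n u" "k < n"
  shows "ip n (vec_index (from_axes n u c)) (u k) = c k"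
proof -
  have "ip n (vec_index (from_axes n u c)) (u k) = ip n (\<lambda>i. \<Sum>l<n. c l * u l i) (u k)"
    by (rule ip_cong) (auto simp: from_axes_def)
  also have "\<dots> = (\<Sum>l<n. c l * ip n (u l) (u k))" by (simp add: ip_sum_left ip_scale_left)
  also have "\<dots> = (\<Sum>l<n. if l = k then c l else 0)"
    using assms by (intro sum.cong refl) (auto simp: orthonormal_def)
  finally show ?thesis using assms(2) by simp
qed

lemma from_axes_ip:
  assumes "orthonormal n n u" "x \<in> carrier_vec n"
  shows "from_axes n u (\<lambda>k. ip n (vec_index x) (u k)) = x"
  using assms orthonormal_expand[OF assms(1), of _ "vec_index x"]
  by (intro eq_vecI) (auto simp: from_axes_def)

lemma eucl_norm_axes:
  assumes "orthonormal n n u" "x \<in> carrier_vec n"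
  shows "eucl_norm x = sqrt (\<Sum>k<n. (ip n (vec_index x) (u k))\<^sup>2)"
  unfolding eucl_norm_def scalar_prod_ip[OF assms(2)]
  by (subst orthonormal_parseval[OF assms(1)]) (simp add: power2_eq_square)

lemma axis_form_from_axes:
  assumes "orthonormal n n u"
  shows "axis_form n u a (from_axes n u c) = (\<Sum>k<n. (c k / a k)\<^sup>2)"
  unfolding axis_form_def by (intro sum.cong refl) (simp add: ip_from_axes[OF assms])

lemma mult_mat_vec_mv:
  assumes "A \<in> carrier_mat n n" "x \<in> carrier_vec n" "i < n"
  shows "(A *\<^sub>v x) $ i = mv n (\<lambda>i j. A $$ (i, j)) (vec_index x) i"
  using assms by (simp add: mv_def scalar_prod_def lessThan_atLeast0)

text \<open>Singular value decomposition: as \<open>A v_k = a_k u_k\<close>, the matrix turns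
  coordinates along \<open>v\<close> into coordinates along \<open>u\<close> multiplied by the
  \<open>a_k\<close>.\<close>

lemma ellipsoid_has_axes:
  assumes "ellipsoid n E"
  obtains u a where "has_axes n u a E"
proof -
  obtain A where A: "A \<in> carrier_mat n n" "invertible_mat A" "E = (\<lambda>x. A *\<^sub>v x) ` unit_ball n"
    using assms by (auto simp: ellipsoid_def)
  obtain B where B: "inverts_mat B A" "inverts_mat A B" using A(2) by (auto simp: invertible_mat_def)
  have Bc: "B \<in> carrier_mat n n" and BA: "B * A = 1\<^sub>m n"
  proof -
    have d: "dim_row A = n" "dim_col A = n" using A(1) by auto
    have 1: "B * A = 1\<^sub>m (dim_row B)" "A * B = 1\<^sub>m n" using B d by (auto simp: inverts_mat_def)
    have "dim_col B = n" using 1(2) by (metis index_mult_mat(3) index_one_mat(3))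
    moreover have "dim_row B = n" using 1(1) d by (metis index_mult_mat(3) index_one_mat(3))
    ultimately show "B \<in> carrier_mat n n" "B * A = 1\<^sub>m n" using 1 by auto
  qed
  define M where "M = (\<lambda>i j. A $$ (i, j))"
  obtain v where v: "orthonormal n n v"
    and orth: "\<And>k l. k < n \<Longrightarrow> l < n \<Longrightarrow> k \<noteq> l \<Longrightarrow> ip n (mv n M (v k)) (mv n M (v l)) = 0"
    using singular_vectors by blast
  define a where "a k = sqrt (ip n (mv n M (v k)) (mv n M (v k)))" for k
  define u where "u k i = mv n M (v k) i / a k" for k i
  \<comment> \<open>A vanishing singular value would put the unit vector \<open>v k\<close> into the
    kernel of an invertible matrix.\<close>
  have a_pos: "a k > 0" if "k < n" for k
  proof (rule ccontr)
    assume "\<not> ?thesis"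
    then have "ip n (mv n M (v k)) (mv n M (v k)) = 0"
      using ip_self_nonneg[of n "mv n M (v k)"] by (simp add: a_def)
    then have z: "mv n M (v k) i = 0" if "i < n" for i
      using ip_self_pos[OF that, of "mv n M (v k)"] by fastforce
    have "A *\<^sub>v vec n (v k) = 0\<^sub>v n"
    proof (rule eq_vecI)
      fix i assume "i < dim_vec (0\<^sub>v n :: real vec)"
      then have i: "i < n" by simp
      have "mv n M (vec_index (vec n (v k))) = mv n M (v k)" by (rule mv_cong) simp
      then show "(A *\<^sub>v vec n (v k)) $ i = 0\<^sub>v n $ i"
        using mult_mat_vec_mv[OF A(1) _ i, of "vec n (v k)"] z[OF i] i by (simp add: M_def)
    qed (use A in auto)
    then have "(B * A) *\<^sub>v vec n (v k) = 0\<^sub>v n"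
      using assoc_mult_mat_vec[OF Bc A(1), of "vec n (v k)"] Bc
      by (auto intro!: eq_vecI simp: scalar_prod_def)
    then have 0: "vec n (v k) = 0\<^sub>v n" by (simp add: BA)
    have "v k i = 0" if "i < n" for i
      using arg_cong[OF 0, of "\<lambda>w. w $ i"] that by simp
    then have "ip n (v k) (v k) = 0" by (simp add: ip_def)
    then show False using v that by (simp add: orthonormal_def)
  qed
  have Mv: "mv n M (v k) = (\<lambda>i. a k * u k i)" if "k < n" for k
    using a_pos[OF that] by (auto simp: u_def)
  have u: "orthonormal n n u"
    unfolding orthonormal_def
  proof (intro allI impI)
    fix k l assume kl: "k < n" "l < n"
    have "ip n (mv n M (v k)) (mv n M (v l)) = a k * (a l * ip n (u k) (u l))"
      by (simp add: Mv kl ip_scale_left ip_scale_right)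
    moreover have "ip n (mv n M (v k)) (mv n M (v k)) = a k * a k"
      using ip_self_nonneg by (simp add: a_def)
    ultimately show "ip n (u k) (u l) = (if k = l then 1 else 0)"
      using orth[OF kl] a_pos[OF kl(1)] a_pos[OF kl(2)] by (auto split: if_splits)
  qed
  have image: "A *\<^sub>v from_axes n v c = from_axes n u (\<lambda>k. a k * c k)" for c
  proof (rule eq_vecI)
    fix i assume "i < dim_vec (from_axes n u (\<lambda>k. a k * c k))"
    then have i: "i < n" by (simp add: from_axes_def)
    have "(A *\<^sub>v from_axes n v c) $ i = mv n M (vec_index (from_axes n v c)) i"
      unfolding M_def by (rule mult_mat_vec_mv[OF A(1) _ i]) simp
    also have "\<dots> = (\<Sum>j<n. \<Sum>k<n. M i j * (c k * v k j))"
      by (simp add: mv_def from_axes_def sum_distrib_left)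
    also have "\<dots> = (\<Sum>k<n. c k * mv n M (v k) i)"
      by (subst sum.swap) (simp add: mv_def sum_distrib_left mult_ac)
    also have "\<dots> = (\<Sum>k<n. a k * c k * u k i)" by (intro sum.cong refl) (simp add: Mv mult_ac)
    finally show "(A *\<^sub>v from_axes n v c) $ i = from_axes n u (\<lambda>k. a k * c k) $ i"
      using i by (simp add: from_axes_def)
  qed (use A in \<open>simp add: from_axes_def\<close>)
  have norm: "eucl_norm (from_axes n v c) = sqrt (\<Sum>k<n. (c k)\<^sup>2)" for c
    by (simp add: eucl_norm_axes[OF v] ip_from_axes[OF v])
  have "E = {x \<in> carrier_vec n. axis_form n u a x \<le> 1}"
  proof (intro equalityI subsetI)
    fix x assume "x \<in> E"
    then obtain y where y: "y \<in> carrier_vec n" "eucl_norm y \<le> 1" "x = A *\<^sub>v y"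
      using A(3) by (auto simp: unit_ball_def)
    obtain c where c: "y = from_axes n v c" using from_axes_ip[OF v y(1)] by metis
    have "axis_form n u a x = (\<Sum>k<n. (c k)\<^sup>2)"
      unfolding y(3) c image axis_form_from_axes[OF u]
      using a_pos by (intro sum.cong refl) (metis lessThan_iff less_irrefl nonzero_mult_div_cancel_left)
    then show "x \<in> {x \<in> carrier_vec n. axis_form n u a x \<le> 1}"
      using y c image by (simp add: norm)
  next
    fix x assume "x \<in> {x \<in> carrier_vec n. axis_form n u a x \<le> 1}"
    then have x: "x \<in> carrier_vec n" "axis_form n u a x \<le> 1" by auto
    define c where "c k = ip n (vec_index x) (u k) / a k" for k
    have "from_axes n u (\<lambda>k. a k * c k) = from_axes n u (\<lambda>k. ip n (vec_index x) (u k))"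
      unfolding from_axes_def using a_pos
      by (intro eq_vecI) (auto simp: c_def intro!: sum.cong, metis less_irrefl)
    then have "x = A *\<^sub>v from_axes n v c" using from_axes_ip[OF u x(1)] by (simp add: image)
    moreover have "from_axes n v c \<in> unit_ball n"
      using x(2) by (simp add: unit_ball_def norm axis_form_def c_def)
    ultimately show "x \<in> E" using A(3) by blast
  qed
  then have "has_axes n u a E" using u a_pos by (simp add: has_axes_def)
  then show thesis by (rule that)
qed

lemma has_axes_polar:
  assumes "has_axes n u a E"
  shows "has_axes n u (\<lambda>k. 1 / a k) (polar n E)"
proof -
  have u: "orthonormal n n u" and a: "\<And>k. k < n \<Longrightarrow> a k > 0"
    and E: "E = {x \<in> carrier_vec n. axis_form n u a x \<le> 1}" using assms by (auto simp: has_axes_def)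
  define co where "co x k = ip n (vec_index x) (u k)" for x k
  have sp: "y \<bullet> x = (\<Sum>k<n. co y k * co x k)" if "x \<in> carrier_vec n" for x y
    unfolding scalar_prod_ip[OF that] co_def by (rule orthonormal_parseval[OF u])
  have "(\<forall>x\<in>E. y \<bullet> x \<le> 1) \<longleftrightarrow> axis_form n u (\<lambda>k. 1 / a k) y \<le> 1" if y: "y \<in> carrier_vec n" for y
  proof
    define Q where "Q = (\<Sum>k<n. (a k * co y k)\<^sup>2)"
    have Q: "axis_form n u (\<lambda>k. 1 / a k) y = Q"
      by (simp add: axis_form_def Q_def co_def mult.commute)
    {
      assume *: "\<forall>x\<in>E. y \<bullet> x \<le> 1"
      show "axis_form n u (\<lambda>k. 1 / a k) y \<le> 1"
      proof (cases "Q \<le> 0")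
        case False
        \<comment> \<open>The point of \<open>E\<close> at which the functional \<open>y\<close> is
          largest; the value there is \<open>sqrt Q\<close>.\<close>
        define x where "x = from_axes n u (\<lambda>k. (a k)\<^sup>2 * co y k / sqrt Q)"
        have "axis_form n u a x = (\<Sum>k<n. (a k * co y k)\<^sup>2 / Q)"
          unfolding x_def axis_form_from_axes[OF u]
        proof (intro sum.cong refl)
          fix k assume "k \<in> {..<n}"
          then show "((a k)\<^sup>2 * co y k / sqrt Q / a k)\<^sup>2 = (a k * co y k)\<^sup>2 / Q"
            using a[of k] False by (simp add: field_simps power2_eq_square)
        qed
        also have "\<dots> = 1" using False by (simp add: sum_divide_distrib[symmetric] Q_def)
        finally have "x \<in> E" by (simp add: E x_def)
        then have "y \<bullet> x \<le> 1" using * by blast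
        moreover have "y \<bullet> x = (\<Sum>k<n. (a k * co y k)\<^sup>2 / sqrt Q)"
          by (subst sp) (auto simp: x_def, auto simp: co_def ip_from_axes[OF u] power2_eq_square mult_ac intro!: sum.cong)
        moreover have "\<dots> = Q / sqrt Q" by (simp add: sum_divide_distrib[symmetric] Q_def)
        ultimately have "sqrt Q \<le> 1" by (simp add: real_div_sqrt False less_imp_le not_le[symmetric])
        then show ?thesis by (simp add: Q)
      qed (simp add: Q)
    }
    assume Q1: "axis_form n u (\<lambda>k. 1 / a k) y \<le> 1"
    show "\<forall>x\<in>E. y \<bullet> x \<le> 1"
    proof
      fix x assume "x \<in> E"
      then have x: "x \<in> carrier_vec n" "(\<Sum>k<n. (co x k / a k)\<^sup>2) \<le> 1"
        by (auto simp: E axis_form_def co_def)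
      \<comment> \<open>Arithmetic-geometric mean inequality term by term, after \<open>a k\<close>
        is shifted from one factor to the other; both sums of squares are at most 1.\<close>
      have "y \<bullet> x \<le> (\<Sum>k<n. ((a k * co y k)\<^sup>2 + (co x k / a k)\<^sup>2) / 2)"
        unfolding sp[OF x(1)]
      proof (intro sum_mono)
        fix k assume "k \<in> {..<n}"
        then have "co y k * co x k = (a k * co y k) * (co x k / a k)" using a[of k] by simp
        then show "co y k * co x k \<le> ((a k * co y k)\<^sup>2 + (co x k / a k)\<^sup>2) / 2"
          using sum_squares_bound[of "a k * co y k" "co x k / a k"] a[of k] \<open>k \<in> {..<n}\<close> by simp
      qed
      also have "\<dots> = (Q + (\<Sum>k<n. (co x k / a k)\<^sup>2)) / 2"
        by (simp add: sum_divide_distrib[symmetric] sum.distrib Q_def)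
      finally show "y \<bullet> x \<le> 1" using Q1 Q x(2) by simp
    qed
  qed
  then have "polar n E = {x \<in> carrier_vec n. axis_form n u (\<lambda>k. 1 / a k) x \<le> 1}"
    by (auto simp: polar_def)
  then show ?thesis using u a by (simp add: has_axes_def)
qed

section \<open>The gauge of an ellipsoid\<close>

lemma axis_form_smult:
  "x \<in> carrier_vec n \<Longrightarrow> axis_form n u a (t \<cdot>\<^sub>v x) = t\<^sup>2 * axis_form n u a x"
proof -
  assume x: "x \<in> carrier_vec n"
  have "ip n (vec_index (t \<cdot>\<^sub>v x)) (u k) = t * ip n (vec_index x) (u k)" for k
    unfolding ip_scale_left[symmetric] using x by (intro ip_cong) auto
  then show ?thesis
    by (simp add: axis_form_def sum_distrib_left power_mult_distrib power_divide)
qed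

lemma body_norm_has_axes:
  assumes "has_axes n u a E" "x \<in> carrier_vec n"
  shows "body_norm E x = sqrt (axis_form n u a x)"
proof -
  have E: "E = {x \<in> carrier_vec n. axis_form n u a x \<le> 1}" using assms by (auto simp: has_axes_def)
  define q where "q = sqrt (axis_form n u a x)"
  have q: "q \<ge> 0" "q\<^sup>2 = axis_form n u a x"
    by (auto simp: q_def axis_form_def intro!: sum_nonneg)
  have mem: "x \<in> (\<lambda>y. t \<cdot>\<^sub>v y) ` E \<longleftrightarrow> q \<le> t" if t: "t > 0" for t
  proof -
    have "x \<in> (\<lambda>y. t \<cdot>\<^sub>v y) ` E \<longleftrightarrow> (1 / t) \<cdot>\<^sub>v x \<in> E"
    proof
      assume "x \<in> (\<lambda>y. t \<cdot>\<^sub>v y) ` E"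
      then show "(1 / t) \<cdot>\<^sub>v x \<in> E" using t by (auto simp: smult_smult_assoc)
    next
      assume "(1 / t) \<cdot>\<^sub>v x \<in> E"
      moreover have "x = t \<cdot>\<^sub>v ((1 / t) \<cdot>\<^sub>v x)" using t by (simp add: smult_smult_assoc)
      ultimately show "x \<in> (\<lambda>y. t \<cdot>\<^sub>v y) ` E" by blast
    qed
    also have "\<dots> \<longleftrightarrow> (1 / t)\<^sup>2 * q\<^sup>2 \<le> 1"
      using assms(2) by (simp add: E axis_form_smult q)
    also have "\<dots> \<longleftrightarrow> q\<^sup>2 \<le> t\<^sup>2" using t by (simp add: power_divide field_simps)
    also have "\<dots> \<longleftrightarrow> q \<le> t" using t q(1) by simp
    finally show ?thesis .
  qed
  have "{t. t > 0 \<and> x \<in> (\<lambda>y. t \<cdot>\<^sub>v y) ` E} = {t. t > 0 \<and> q \<le> t}" using mem by auto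
  also have "Inf \<dots> = q"
  \<comment> \<open>At \<open>q = 0\<close> the set is an open half-line, so the infimum is not
    attained and needs its own case.\<close>
  proof (cases "q = 0")
    case True
    then have "{t. t > 0 \<and> q \<le> t} = {0<..}" by auto
    then show ?thesis using True by simp
  next
    case False
    then have "{t. t > 0 \<and> q \<le> t} = {q..}" using q by auto
    then show ?thesis by simp
  qed
  finally show ?thesis by (simp add: body_norm_def q_def)
qed

section \<open>Volume and covering numbers of ellipsoids\<close>

text \<open>A vector and its extensional representative agree only below \<open>n\<close>, so the
  predicate must not look at any other index.\<close>

lemma coords_image:
  assumes "\<And>x y. (\<And>i. i < n \<Longrightarrow> x i = y i) \<Longrightarrow> P x = P y"
  shows "(\<lambda>x. restrict (\<lambda>i. x $ i) {..<n}) ` {x \<in> carrier_vec n. P (vec_index x)} =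
    {f \<in> space (leb {..<n}). P f}"
proof (intro equalityI subsetI)
  fix f assume "f \<in> (\<lambda>x. restrict (\<lambda>i. x $ i) {..<n}) ` {x \<in> carrier_vec n. P (vec_index x)}"
  then obtain x where x: "x \<in> carrier_vec n" "P (vec_index x)" "f = restrict (\<lambda>i. x $ i) {..<n}" by blast
  have "P f \<longleftrightarrow> P (vec_index x)" by (rule assms) (simp add: x(3))
  then show "f \<in> {f \<in> space (leb {..<n}). P f}" using x(2,3) by (simp add: space_PiM)
next
  fix f assume f: "f \<in> {f \<in> space (leb {..<n}). P f}"
  have eq: "P (vec_index (vec n f)) = P f" by (rule assms) simp
  have mem: "vec n f \<in> {x \<in> carrier_vec n. P (vec_index x)}" using f eq by simp
  have "f \<in> extensional {..<n}" using f by (simp add: space_PiM PiE_def)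
  then have "f = restrict (\<lambda>i. vec n f $ i) {..<n}"
    by (intro ext) (simp add: extensional_def)
  then show "f \<in> (\<lambda>x. restrict (\<lambda>i. x $ i) {..<n}) ` {x \<in> carrier_vec n. P (vec_index x)}"
    by (rule image_eqI[OF _ mem])
qed

lemma volume_unit_ball: "volume n (unit_ball n) = measure (leb {..<n}) (pball {..<n} {})"
proof -
  have "unit_ball n = {x \<in> carrier_vec n. ip n (vec_index x) (vec_index x) \<le> 1}"
    by (auto simp: unit_ball_def eucl_norm_def scalar_prod_ip)
  also have "(\<lambda>x. restrict (\<lambda>i. x $ i) {..<n}) ` \<dots> = {f \<in> space (leb {..<n}). ip n f f \<le> 1}"
    by (rule coords_image) (simp add: ip_def)
  also have "\<dots> = pball {..<n} {}" by (simp add: pball_def ip_def power2_eq_square)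
  finally show ?thesis by (simp only: volume_def)
qed

lemma volume_unit_ball_pos: "volume n (unit_ball n) > 0"
  using pball_pos_finite[of "{..<n}" "{}"]
  by (auto simp: volume_unit_ball measure_def enn2real_positive_iff)

text \<open>Passing to coordinates along the axes is orthogonal, and dividing them by the semi-axes
  is a scaling to the unit ball.\<close>

lemma volume_has_axes:
  assumes "has_axes n u a E"
  shows "volume n E = (\<Prod>k<n. a k) * volume n (unit_ball n)"
proof -
  let ?I = "{..<n}"
  have u: "orthonormal n n u" and a: "\<And>k. k < n \<Longrightarrow> a k > 0"
    and E: "E = {x \<in> carrier_vec n. axis_form n u a x \<le> 1}" using assms by (auto simp: has_axes_def)
  define Y where "Y = {g \<in> space (leb ?I). (\<lambda>k\<in>?I. g k / a k) \<in> pball ?I {}}"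
  have "(\<lambda>g. \<lambda>k\<in>?I. g k / a k) \<in> measurable (leb ?I) (leb ?I)" by measurable
  then have Y: "Y \<in> sets (leb ?I)"
    unfolding Y_def by (rule sets_vimage_Collect) (simp add: pball_sets)
  have "(\<lambda>x. restrict (\<lambda>i. x $ i) ?I) ` E = {f \<in> space (leb ?I). (\<Sum>k<n. (ip n f (u k) / a k)\<^sup>2) \<le> 1}"
    unfolding E axis_form_def by (rule coords_image) (simp add: ip_def)
  also have "\<dots> = {f \<in> space (leb ?I). lin ?I u f \<in> Y}"
    by (auto simp: Y_def pball_def lin_def ip_def space_PiM mult.commute)
  also have "emeasure (leb ?I) \<dots> = emeasure (leb ?I) Y"
  proof (rule emeasure_orthogonal[OF _ Y])
    show "(\<Sum>j<n. u i j * u k j) = (if i = k then 1 else 0)" if "i \<in> ?I" "k \<in> ?I" for i k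
      using u that by (simp add: orthonormal_def ip_def)
    show "(\<Sum>j<n. u j i * u j k) = (if i = k then 1 else 0)" if "i \<in> ?I" "k \<in> ?I" for i k
      using orthonormal_columns[OF u] that by simp
  qed simp
  also have "\<dots> = ennreal (\<Prod>k<n. a k) * emeasure (leb ?I) (pball ?I {})"
    unfolding Y_def using a by (intro emeasure_scale) auto
  moreover have "0 \<le> (\<Prod>k<n. a k)" using a by (intro prod_nonneg) (simp add: less_imp_le)
  ultimately show ?thesis
    by (simp add: volume_def[of n E] measure_def enn2real_mult volume_unit_ball)
qed

lemma volume_radius_has_axes:
  "has_axes n u a E \<Longrightarrow> volume_radius n E = root n (\<Prod>k<n. a k)"
  using volume_unit_ball_pos[of n] by (simp add: volume_radius_def volume_has_axes)

text \<open>The projection onto the axes in \<open>\<rho>\<close> is multiplied by a unit ball in the remaining axes, so that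
  only \<open>n\<close>-dimensional volumes have to be compared.\<close>

lemma axes_prod_le_cover:
  assumes axes: "has_axes n u a E" and \<mu>: "\<mu> > 0" and \<rho>: "\<rho> \<subseteq> {..<n}"
    and x: "\<And>i. i < N \<Longrightarrow> x i \<in> carrier_vec n"
    and cover: "E \<subseteq> (\<Union>i<N. (\<lambda>b. x i + b) ` (\<lambda>x. \<mu> \<cdot>\<^sub>v x) ` unit_ball n)"
  shows "(\<Prod>k\<in>\<rho>. a k) \<le> real N * \<mu> ^ card \<rho>"
proof -
  let ?I = "{..<n}"
  have u: "orthonormal n n u" and a: "\<And>k. k < n \<Longrightarrow> a k > 0"
    and E: "E = {x \<in> carrier_vec n. axis_form n u a x \<le> 1}" using axes by (auto simp: has_axes_def)
  have fin: "finite \<rho>" using \<rho> by (rule finite_subset) simp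
  \<comment> \<open>An ellipsoid with semi-axes \<open>w\<close> over \<open>\<rho>\<close> times a
    unit ball over the other coordinates. All such volumes contain the factor
    \<open>pball ?I \<rho>\<close>, which cancels in the end.\<close>
  define C where "C w = {f \<in> space (leb ?I). (\<lambda>k\<in>?I. f k / (if k \<in> \<rho> then w k else 1)) \<in> pball ?I \<rho>}" for w
  have C_sets: "C w \<in> sets (leb ?I)" for w
  proof -
    have "(\<lambda>g. \<lambda>k\<in>?I. g k / (if k \<in> \<rho> then w k else 1)) \<in> measurable (leb ?I) (leb ?I)" by measurable
    then show ?thesis
      unfolding C_def by (rule sets_vimage_Collect) (simp add: pball_sets \<rho>)
  qed
  have C_vol: "emeasure (leb ?I) (C w) = ennreal (\<Prod>k\<in>\<rho>. w k) * emeasure (leb ?I) (pball ?I \<rho>)"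
    if "\<And>k. k < n \<Longrightarrow> w k > 0" for w
  proof -
    have "emeasure (leb ?I) (C w) =
        ennreal (\<Prod>k\<in>?I. if k \<in> \<rho> then w k else 1) * emeasure (leb ?I) (pball ?I \<rho>)"
      unfolding C_def using that \<rho> by (intro emeasure_scale) auto
    also have "(\<Prod>k\<in>?I. if k \<in> \<rho> then w k else 1) = (\<Prod>k\<in>\<rho>. w k)"
      using \<rho> by (simp add: prod.If_cases Int_absorb1)
    finally show ?thesis .
  qed
  have C_iff: "f \<in> C w \<longleftrightarrow> f \<in> space (leb ?I) \<and> (\<Sum>k\<in>\<rho>. (f k / w k)\<^sup>2) \<le> 1 \<and> (\<Sum>k\<in>?I-\<rho>. (f k)\<^sup>2) \<le> 1" for f w
  proof -
    have "(\<Sum>k\<in>\<rho>. ((\<lambda>k\<in>?I. f k / (if k \<in> \<rho> then w k else 1)) k)\<^sup>2) = (\<Sum>k\<in>\<rho>. (f k / w k)\<^sup>2)"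
      using \<rho> by (intro sum.cong refl) auto
    moreover have "(\<Sum>k\<in>?I-\<rho>. ((\<lambda>k\<in>?I. f k / (if k \<in> \<rho> then w k else 1)) k)\<^sup>2) = (\<Sum>k\<in>?I-\<rho>. (f k)\<^sup>2)"
      by (intro sum.cong refl) auto
    ultimately show ?thesis by (auto simp: C_def pball_def space_PiM)
  qed
  \<comment> \<open>Minus the projected centre: adding it moves the projected ball to the origin and
    leaves the coordinates outside \<open>\<rho>\<close> alone.\<close>
  define y where "y i = (\<lambda>k. if k \<in> \<rho> then - ip n (vec_index (x i)) (u k) else 0)" for i
  have "C a \<subseteq> (\<Union>i<N. {f \<in> space (leb ?I). padd ?I f (y i) \<in> C (\<lambda>_. \<mu>)})"
  proof
    fix f assume f: "f \<in> C a"
    \<comment> \<open>A lift of the projected point into \<open>E\<close>, where the covering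
      applies: its coordinates along the remaining axes are zero.\<close>
    define z where "z = from_axes n u (\<lambda>k. if k \<in> \<rho> then f k else 0)"
    have "axis_form n u a z = (\<Sum>k<n. if k \<in> \<rho> then (f k / a k)\<^sup>2 else 0)"
      unfolding z_def axis_form_from_axes[OF u] by (intro sum.cong refl) auto
    also have "\<dots> = (\<Sum>k\<in>\<rho>. (f k / a k)\<^sup>2)"
      using \<rho> by (simp add: sum.If_cases Int_absorb1)
    finally have "z \<in> E" using f by (simp add: E C_iff z_def)
    then obtain i b where i: "i < N" "b \<in> unit_ball n" "z = x i + \<mu> \<cdot>\<^sub>v b"
      using cover by auto
    have b: "b \<in> carrier_vec n" using i(2) by (simp add: unit_ball_def)
    have zk: "ip n (vec_index z) (u k) = ip n (vec_index (x i)) (u k) + \<mu> * ip n (vec_index b) (u k)" for k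
      unfolding ip_scale_left[symmetric] ip_add_left[symmetric]
      using x[OF i(1)] b by (intro ip_cong) (auto simp: i(3))
    have diff: "(f k + y i k) / \<mu> = ip n (vec_index b) (u k)" if "k \<in> \<rho>" for k
    proof -
      have "ip n (vec_index z) (u k) = f k"
        unfolding z_def using that \<rho> by (subst ip_from_axes[OF u]) auto
      then show ?thesis using zk[of k] that \<mu> by (simp add: y_def field_simps)
    qed
    have "(\<Sum>k\<in>\<rho>. ((f k + y i k) / \<mu>)\<^sup>2) = (\<Sum>k\<in>\<rho>. (ip n (vec_index b) (u k))\<^sup>2)"
      by (intro sum.cong refl) (simp add: diff)
    also have "\<dots> \<le> (\<Sum>k<n. (ip n (vec_index b) (u k))\<^sup>2)" using \<rho> by (intro sum_mono2) auto
    also have "\<dots> \<le> 1"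
      using i(2) eucl_norm_axes[OF u b] by (simp add: unit_ball_def)
    finally have 1: "(\<Sum>k\<in>\<rho>. ((f k + y i k) / \<mu>)\<^sup>2) \<le> 1" .
    have "(\<Sum>k\<in>\<rho>. (padd ?I f (y i) k / \<mu>)\<^sup>2) = (\<Sum>k\<in>\<rho>. ((f k + y i k) / \<mu>)\<^sup>2)"
      using \<rho> by (intro sum.cong refl) (auto simp: padd_def)
    moreover have "(\<Sum>k\<in>?I-\<rho>. (padd ?I f (y i) k)\<^sup>2) = (\<Sum>k\<in>?I-\<rho>. (f k)\<^sup>2)"
      by (intro sum.cong refl) (auto simp: padd_def y_def)
    ultimately have "padd ?I f (y i) \<in> C (\<lambda>_. \<mu>)" using 1 f by (simp add: C_iff)
    then show "f \<in> (\<Union>i<N. {f \<in> space (leb ?I). padd ?I f (y i) \<in> C (\<lambda>_. \<mu>)})"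
      using i(1) f by (auto simp: C_iff)
  qed
  moreover have sets: "{f \<in> space (leb ?I). padd ?I f (y i) \<in> C (\<lambda>_. \<mu>)} \<in> sets (leb ?I)" for i
    by (rule sets_vimage_Collect[OF padd_measurable C_sets])
  ultimately have "emeasure (leb ?I) (C a) \<le>
    emeasure (leb ?I) (\<Union>i<N. {f \<in> space (leb ?I). padd ?I f (y i) \<in> C (\<lambda>_. \<mu>)})"
    by (intro emeasure_mono sets.finite_UN) auto
  also have "\<dots> \<le> (\<Sum>i<N. emeasure (leb ?I) {f \<in> space (leb ?I). padd ?I f (y i) \<in> C (\<lambda>_. \<mu>)})"
    using sets by (intro emeasure_subadditive_finite) auto
  also have "\<dots> = (\<Sum>i<N. emeasure (leb ?I) (C (\<lambda>_. \<mu>)))"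
    using C_sets by (intro sum.cong refl emeasure_padd) auto
  also have "\<dots> = ennreal (real N * \<mu> ^ card \<rho>) * emeasure (leb ?I) (pball ?I \<rho>)"
    using \<mu> by (simp add: C_vol ennreal_mult ennreal_of_nat_eq_real_of_nat mult.assoc)
  finally have "ennreal (\<Prod>k\<in>\<rho>. a k) * emeasure (leb ?I) (pball ?I \<rho>) \<le>
     ennreal (real N * \<mu> ^ card \<rho>) * emeasure (leb ?I) (pball ?I \<rho>)"
    by (simp add: C_vol a)
  then have "\<not> ennreal (real N * \<mu> ^ card \<rho>) < ennreal (\<Prod>k\<in>\<rho>. a k)"
    using ennreal_mult_strict_right_mono[of "ennreal (real N * \<mu> ^ card \<rho>)" "ennreal (\<Prod>k\<in>\<rho>. a k)"
        "emeasure (leb ?I) (pball ?I \<rho>)"] pball_pos_finite[of ?I \<rho>] \<rho> by (auto simp: not_le)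
  then show ?thesis using \<mu> by (simp add: ennreal_less_iff not_less)
qed

text \<open>Without any finite cover, the \<open>LEAST\<close> in \<open>covering_number\<close>
  would not be attained and would say nothing about \<open>E\<close>. A grid of mesh
  \<open>\<mu> / n\<close> in axis coordinates works: each of the \<open>n\<close> coordinates is
  off by at most \<open>\<mu> / n\<close>, so the error has norm at most
  \<open>\<mu>\<close>.\<close>

lemma finite_cover_exists:
  assumes axes: "has_axes n u a E" and \<mu>: "\<mu> > 0" and n: "n \<ge> 1"
  shows "\<exists>N. \<exists>x :: nat \<Rightarrow> real vec. (\<forall>i<N. x i \<in> carrier_vec n) \<and>
     E \<subseteq> (\<Union>i<N. (\<lambda>b. x i + b) ` (\<lambda>x. \<mu> \<cdot>\<^sub>v x) ` unit_ball n)"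
proof -
  have u: "orthonormal n n u" and a: "\<And>k. k < n \<Longrightarrow> a k > 0"
    and E: "E = {x \<in> carrier_vec n. axis_form n u a x \<le> 1}" using axes by (auto simp: has_axes_def)
  define h where "h = \<mu> / real n"
  have h: "h > 0" "real n * h = \<mu>" using \<mu> n by (auto simp: h_def)
  define K where "K = \<lceil>Max (insert 0 (a ` {..<n})) / h\<rceil> + 1"
  define Z where "Z = from_axes n u ` (\<lambda>z k. h * real_of_int (z k)) ` (PiE {..<n} (\<lambda>_. {-K..K}))"
  have "finite Z" unfolding Z_def by (intro finite_imageI finite_PiE) auto
  from finite_imp_nat_seg_image_inj_on[OF this]
  obtain N :: nat and x where x: "Z = x ` {i. i < N}" by (elim exE conjE)
  have xc: "x i \<in> carrier_vec n" if "i < N" for i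
  proof -
    have "x i \<in> Z" unfolding x using that by (intro imageI CollectI)
    then show ?thesis unfolding Z_def by (elim imageE) (simp only: from_axes_carrier)
  qed
  have "E \<subseteq> (\<Union>i<N. (\<lambda>b. x i + b) ` (\<lambda>x. \<mu> \<cdot>\<^sub>v x) ` unit_ball n)"
  proof
    fix p assume p: "p \<in> E"
    then have pc: "p \<in> carrier_vec n" by (simp add: E)
    define c where "c k = ip n (vec_index p) (u k)" for k
    define z where "z = restrict (\<lambda>k. \<lfloor>c k / h\<rfloor>) {..<n}"
    have c_le: "\<bar>c k\<bar> \<le> a k" if "k < n" for k
    proof -
      have "(c k / a k)\<^sup>2 \<le> axis_form n u a p"
        unfolding axis_form_def c_def using that by (intro member_le_sum) auto
      also have "\<dots> \<le> 1" using p by (simp add: E)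
      finally have "\<bar>c k / a k\<bar> \<le> 1" by (simp add: abs_square_le_1)
      then show ?thesis using a[OF that] by (simp add: field_simps)
    qed
    have "z k \<in> {-K..K}" if "k < n" for k
    proof -
      have "a k \<le> Max (insert 0 (a ` {..<n}))" using that by (intro Max_ge) auto
      then have "a k / h \<le> Max (insert 0 (a ` {..<n})) / h" using h by (simp add: divide_right_mono)
      also have "\<dots> \<le> real_of_int K - 1" by (simp add: K_def)
      finally have 1: "a k / h \<le> real_of_int K - 1" .
      have "\<bar>c k / h\<bar> \<le> a k / h"
        unfolding abs_divide abs_of_pos[OF h(1)] using c_le[OF that] h(1) by (intro divide_right_mono) auto
      then have "- (real_of_int K - 1) \<le> c k / h" "c k / h \<le> real_of_int K - 1"
        using 1 by (simp_all only: abs_le_iff) simp_all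
      then have "-K \<le> \<lfloor>c k / h\<rfloor>" "\<lfloor>c k / h\<rfloor> \<le> K"
        by (simp_all add: le_floor_iff floor_le_iff)
      then show ?thesis using that by (simp add: z_def)
    qed
    then have "z \<in> PiE {..<n} (\<lambda>_. {-K..K})" by (auto simp: z_def)
    then have "from_axes n u (\<lambda>k. h * real_of_int (z k)) \<in> Z" unfolding Z_def by blast
    then obtain i where i: "i < N" "x i = from_axes n u (\<lambda>k. h * real_of_int (z k))"
      unfolding x by (elim imageE CollectE) (rule that, simp_all)
    define b where "b = from_axes n u (\<lambda>k. (c k - h * real_of_int (z k)) / \<mu>)"
    have "p = from_axes n u c" unfolding c_def using from_axes_ip[OF u pc] by simp
    also have "\<dots> = x i + \<mu> \<cdot>\<^sub>v b"
      unfolding i(2) b_def using \<mu>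
      by (intro eq_vecI)
        (auto simp: from_axes_def sum_distrib_left sum.distrib[symmetric] algebra_simps diff_divide_distrib intro!: sum.cong)
    finally have "p = x i + \<mu> \<cdot>\<^sub>v b" .
    moreover have "b \<in> unit_ball n"
    proof -
      have "(\<Sum>k<n. ((c k - h * real_of_int (z k)) / \<mu>)\<^sup>2) \<le> (\<Sum>k<n. 1 / real n)"
      proof (intro sum_mono)
        fix k assume "k \<in> {..<n}"
        then have "z k = \<lfloor>c k / h\<rfloor>" by (simp add: z_def)
        then have "real_of_int (z k) \<le> c k / h" "c k / h < real_of_int (z k) + 1" by simp_all
        then have "0 \<le> c k - h * real_of_int (z k)" "c k - h * real_of_int (z k) \<le> h"
          using h by (auto simp: field_simps)
        then have "0 \<le> (c k - h * real_of_int (z k)) / \<mu>" "(c k - h * real_of_int (z k)) / \<mu> \<le> 1 / real n"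
          using \<mu> n by (auto simp: h_def field_simps)
        then have "((c k - h * real_of_int (z k)) / \<mu>)\<^sup>2 \<le> (1 / real n)\<^sup>2" by (rule power_mono[rotated])
        also have "\<dots> \<le> 1 / real n" using n by (simp add: power2_eq_square field_simps)
        finally show "((c k - h * real_of_int (z k)) / \<mu>)\<^sup>2 \<le> 1 / real n" .
      qed
      also have "\<dots> = 1" using n by simp
      finally show ?thesis
        by (simp add: unit_ball_def b_def eucl_norm_axes[OF u] ip_from_axes[OF u])
    qed
    ultimately show "p \<in> (\<Union>i<N. (\<lambda>b. x i + b) ` (\<lambda>x. \<mu> \<cdot>\<^sub>v x) ` unit_ball n)"
      using i(1) by blast
  qed
  with xc show ?thesis by (intro exI[of _ N] exI[of _ x] conjI allI impI)
qed

text \<open>The set \<open>\<rho>\<close> is free, so it can later consist of the long axes only,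
  and no short axis offsets their logarithms.\<close>

lemma M_position_axes:
  assumes axes: "has_axes n u a E" and M: "M_position n \<delta> E" and n: "n \<ge> 1" and \<rho>: "\<rho> \<subseteq> {..<n}"
  shows "(\<Sum>k\<in>\<rho>. ln (a k / volume_radius n E)) \<le> \<delta> * real n"
proof -
  have a: "\<And>k. k < n \<Longrightarrow> a k > 0" using axes by (auto simp: has_axes_def)
  define \<mu> where "\<mu> = volume_radius n E"
  have \<mu>: "\<mu> > 0" using n a by (auto simp: \<mu>_def volume_radius_has_axes[OF axes] intro!: prod_pos)
  define N where "N = covering_number n E ((\<lambda>x. \<mu> \<cdot>\<^sub>v x) ` unit_ball n)"
  have "\<exists>x :: nat \<Rightarrow> real vec. (\<forall>i<N. x i \<in> carrier_vec n) \<and>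
     E \<subseteq> (\<Union>i<N. (\<lambda>b. x i + b) ` (\<lambda>x. \<mu> \<cdot>\<^sub>v x) ` unit_ball n)"
    unfolding N_def covering_number_def by (rule LeastI_ex) (rule finite_cover_exists[OF axes \<mu> n])
  then obtain x where x: "\<And>i. i < N \<Longrightarrow> x i \<in> carrier_vec n"
    "E \<subseteq> (\<Union>i<N. (\<lambda>b. x i + b) ` (\<lambda>x. \<mu> \<cdot>\<^sub>v x) ` unit_ball n)" by blast
  have fin: "finite \<rho>" using \<rho> by (rule finite_subset) simp
  have "(\<Prod>k\<in>\<rho>. a k) \<le> real N * \<mu> ^ card \<rho>"
    by (rule axes_prod_le_cover[OF axes \<mu> \<rho> x])
  then have le: "(\<Prod>k\<in>\<rho>. a k / \<mu>) \<le> real N"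
    using \<mu> by (simp add: prod_dividef field_simps)
  have pos: "0 < (\<Prod>k\<in>\<rho>. a k / \<mu>)" using a \<mu> \<rho> by (intro prod_pos) auto
  have "(\<Sum>k\<in>\<rho>. ln (a k / \<mu>)) = ln (\<Prod>k\<in>\<rho>. a k / \<mu>)"
    by (intro ln_prod[symmetric] fin) (use a \<mu> \<rho> in force)
  also have "\<dots> \<le> ln (real N)" using le pos by (intro ln_mono) auto
  also have "\<dots> \<le> \<delta> * real n"
    using M n by (simp add: M_position_def N_def \<mu>_def field_simps)
  finally show ?thesis by (simp add: \<mu>_def)
qed

section \<open>Well-conditioned coordinate subsets\<close>

text \<open>The matrix \<open>W diag(d) W^T\<close>. For orthogonal \<open>w\<close> the
  \<open>d k\<close> are its eigenvalues, and its inverse and trace can be written down.\<close>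

definition kern :: "nat \<Rightarrow> (nat \<Rightarrow> nat \<Rightarrow> real) \<Rightarrow> (nat \<Rightarrow> real) \<Rightarrow> nat \<Rightarrow> nat \<Rightarrow> real" where
  "kern n w d i j = (\<Sum>k<n. d k * w i k * w j k)"

lemma kern_commute: "kern n w d i j = kern n w d j i"
  by (simp add: kern_def mult_ac)

lemma bil_kern: "bil {..<n} (kern n w d) x x = (\<Sum>k<n. d k * (\<Sum>i<n. x i * w i k)\<^sup>2)"
proof -
  have "bil {..<n} (kern n w d) x x = (\<Sum>i<n. \<Sum>j<n. \<Sum>k<n. x i * (d k * w i k * w j k * x j))"
    by (simp add: bil_def app_def kern_def sum_distrib_left sum_distrib_right)
  also have "\<dots> = (\<Sum>i<n. \<Sum>k<n. \<Sum>j<n. x i * (d k * w i k * w j k * x j))"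
    by (intro sum.cong refl sum.swap)
  also have "\<dots> = (\<Sum>k<n. \<Sum>i<n. \<Sum>j<n. x i * (d k * w i k * w j k * x j))"
    by (rule sum.swap)
  also have "\<dots> = (\<Sum>k<n. d k * (\<Sum>i<n. x i * w i k)\<^sup>2)"
    by (simp add: power2_eq_square sum_product sum_distrib_left mult_ac)
  finally show ?thesis .
qed

lemma kern_mult:
  assumes col: "\<And>k l. k < n \<Longrightarrow> l < n \<Longrightarrow> (\<Sum>j<n. w j k * w j l) = (if k = l then 1 else 0)"
  shows "(\<Sum>j<n. kern n w d i j * kern n w d' j l) = kern n w (\<lambda>k. d k * d' k) i l"
proof -
  have "(\<Sum>j<n. kern n w d i j * kern n w d' j l) =
    (\<Sum>j<n. \<Sum>k<n. \<Sum>h<n. d k * w i k * (d' h * w l h) * (w j k * w j h))"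
    by (simp add: kern_def sum_product mult_ac)
  also have "\<dots> = (\<Sum>k<n. \<Sum>j<n. \<Sum>h<n. d k * w i k * (d' h * w l h) * (w j k * w j h))"
    by (rule sum.swap)
  also have "\<dots> = (\<Sum>k<n. \<Sum>h<n. \<Sum>j<n. d k * w i k * (d' h * w l h) * (w j k * w j h))"
    by (intro sum.cong refl sum.swap)
  also have "\<dots> = (\<Sum>k<n. \<Sum>h<n. d k * w i k * (d' h * w l h) * (if k = h then 1 else 0))"
    by (intro sum.cong refl) (simp add: sum_distrib_left[symmetric] col)
  also have "\<dots> = (\<Sum>k<n. \<Sum>h<n. if k = h then d k * w i k * (d' h * w l h) else 0)"
    by (intro sum.cong refl) simp
  also have "\<dots> = kern n w (\<lambda>k. d k * d' k) i l"
    by (simp add: kern_def mult_ac)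
  finally show ?thesis .
qed

lemma trace_kern:
  assumes col: "\<And>k l. k < n \<Longrightarrow> l < n \<Longrightarrow> (\<Sum>j<n. w j k * w j l) = (if k = l then 1 else 0)"
  shows "trace_on {..<n} (kern n w d) = (\<Sum>k<n. d k)"
proof -
  have "trace_on {..<n} (kern n w d) = (\<Sum>k<n. \<Sum>i<n. d k * (w i k * w i k))"
    unfolding trace_on_def kern_def by (subst sum.swap) (simp add: mult.assoc)
  also have "\<dots> = (\<Sum>k<n. d k)"
    by (intro sum.cong refl) (simp add: sum_distrib_left[symmetric] col)
  finally show ?thesis .
qed

lemma kern_norm:
  fixes n :: nat and x :: "nat \<Rightarrow> real"
  assumes row: "\<And>i j. i < n \<Longrightarrow> j < n \<Longrightarrow> (\<Sum>k<n. w i k * w j k) = (if i = j then 1 else 0)"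
  shows "(\<Sum>k<n. (\<Sum>i<n. x i * w i k)\<^sup>2) = (\<Sum>i<n. (x i)\<^sup>2)"
proof -
  have "(\<Sum>k<n. (\<Sum>i<n. x i * w i k)\<^sup>2) = bil {..<n} (kern n w (\<lambda>_. 1)) x x"
    by (simp add: bil_kern)
  also have "\<dots> = (\<Sum>i<n. x i * (\<Sum>j<n. (if i = j then 1 else 0) * x j))"
    unfolding bil_def app_def kern_def by (intro sum.cong refl arg_cong2[where f = times]) (simp_all add: row)
  also have "\<dots> = (\<Sum>i<n. x i * (\<Sum>j<n. if i = j then x j else 0))"
    by (intro sum.cong refl arg_cong2[where f = times]) auto
  finally show ?thesis by (simp add: power2_eq_square)
qed

text \<open>Since \<open>W W^T = 1\<close>, adding \<open>\<beta>\<close> to the matrix adds it to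
  every eigenvalue, and the inverse has the reciprocal eigenvalues.\<close>

lemma pd_inverse_kern:
  assumes row: "\<And>i j. i < n \<Longrightarrow> j < n \<Longrightarrow> (\<Sum>k<n. w i k * w j k) = (if i = j then 1 else 0)"
    and col: "\<And>k l. k < n \<Longrightarrow> l < n \<Longrightarrow> (\<Sum>j<n. w j k * w j l) = (if k = l then 1 else 0)"
    and d: "\<And>k. k < n \<Longrightarrow> d k > 0" and \<beta>: "\<beta> > 0"
  shows "pd_inverse {..<n} (shift (kern n w d) (- \<beta>)) (kern n w (\<lambda>k. 1 / (d k + \<beta>)))"
proof -
  have shift: "shift (kern n w d) (- \<beta>) i j = kern n w (\<lambda>k. d k + \<beta>) i j" if "i < n" "j < n" for i j
  proof -
    have "kern n w (\<lambda>k. d k + \<beta>) i j = kern n w d i j + \<beta> * (\<Sum>k<n. w i k * w j k)"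
      by (simp add: kern_def algebra_simps sum.distrib sum_distrib_left)
    then show ?thesis by (simp add: row[OF that] shift_def)
  qed
  have "pos_def {..<n} (shift (kern n w d) (- \<beta>))"
    unfolding pos_def_def
  proof (intro allI impI)
    fix x :: "nat \<Rightarrow> real" assume "\<exists>i\<in>{..<n}. x i \<noteq> 0"
    then obtain i where i: "i < n" "x i \<noteq> 0" by auto
    have "0 < (\<Sum>i<n. (x i)\<^sup>2)" by (rule sum_pos2[of _ i]) (use i in auto)
    then have "0 < \<beta> * (\<Sum>i<n. (x i)\<^sup>2)" using \<beta> by simp
    moreover have "0 \<le> bil {..<n} (kern n w d) x x"
      unfolding bil_kern using d by (intro sum_nonneg mult_nonneg_nonneg) (auto simp: less_imp_le)
    ultimately show "0 < bil {..<n} (shift (kern n w d) (- \<beta>)) x x"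
      by (simp add: bil_shift power2_eq_square)
  qed
  moreover have "(\<Sum>j<n. shift (kern n w d) (- \<beta>) i j * kern n w (\<lambda>k. 1 / (d k + \<beta>)) j l) = (if i = l then 1 else 0)"
    if "i < n" "l < n" for i l
  proof -
    have "(\<Sum>j<n. shift (kern n w d) (- \<beta>) i j * kern n w (\<lambda>k. 1 / (d k + \<beta>)) j l) =
      (\<Sum>j<n. kern n w (\<lambda>k. d k + \<beta>) i j * kern n w (\<lambda>k. 1 / (d k + \<beta>)) j l)"
      using that by (intro sum.cong refl) (simp add: shift)
    also have "\<dots> = kern n w (\<lambda>k. (d k + \<beta>) * (1 / (d k + \<beta>))) i l"
      by (rule kern_mult[OF col])
    also have "\<dots> = (\<Sum>k<n. w i k * w l k)"
      unfolding kern_def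
    proof (intro sum.cong refl)
      fix k assume "k \<in> {..<n}"
      then have "d k + \<beta> \<noteq> 0" using d[of k] \<beta> by simp
      then show "(d k + \<beta>) * (1 / (d k + \<beta>)) * w i k * w l k = w i k * w l k" by simp
    qed
    finally show ?thesis by (simp add: row that)
  qed
  moreover have "sym_on {..<n} (shift (kern n w d) (- \<beta>))"
    unfolding sym_on_def shift_def by (auto simp: kern_commute[of n w d])
  moreover have "sym_on {..<n} (kern n w (\<lambda>k. 1 / (d k + \<beta>)))"
    unfolding sym_on_def by (intro ballI) (rule kern_commute)
  ultimately show ?thesis unfolding pd_inverse_def by simp
qed

text \<open>The barrier starts at \<open>- s/(16L)\<close>, so the at most \<open>s n/16\<close> eigenvalues below \<open>1/L\<close>
  contribute no more to the initial potential than all the others.\<close>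

lemma coordinate_subset_lower_bound:
  assumes row: "\<And>i j. i < n \<Longrightarrow> j < n \<Longrightarrow> (\<Sum>k<n. w i k * w j k) = (if i = j then 1 else 0)"
    and col: "\<And>k l. k < n \<Longrightarrow> l < n \<Longrightarrow> (\<Sum>j<n. w j k * w j l) = (if k = l then 1 else 0)"
    and \<mu>: "\<And>k. k < n \<Longrightarrow> \<mu> k > 0" and L: "L > 0" and s: "0 < s" "s < 1" and n: "n \<ge> 1"
    and few: "real (card {k. k < n \<and> \<mu> k > L}) \<le> s * real n / 16"
  obtains J where "J \<subseteq> {..<n}" "real (card J) \<ge> (1 - s) * real n"
    "\<And>x. s / (16 * L) * (\<Sum>i\<in>J. (x i)\<^sup>2) \<le> bil J (kern n w (\<lambda>k. 1 / \<mu> k)) x x"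
proof (cases "s * real n < 1")
  case True
  \<comment> \<open>No coordinate may be deleted in this case, but the number of large
    \<open>\<mu> k\<close> is then below 1/16, hence zero, and all coordinates can stay.\<close>
  then have "real (card {k. k < n \<and> \<mu> k > L}) < 1" using few by linarith
  then have "{k. k < n \<and> \<mu> k > L} = {}" by simp
  then have le: "\<mu> k \<le> L" if "k < n" for k using that by force
  show thesis
  proof
    show "(1 - s) * real n \<le> real (card {..<n})" using s by (simp add: algebra_simps)
    fix x :: "nat \<Rightarrow> real"
    have "s / (16 * L) * (\<Sum>i<n. (x i)\<^sup>2) \<le> 1 / L * (\<Sum>i<n. (x i)\<^sup>2)"
      using L s by (intro mult_right_mono sum_nonneg) (auto simp: field_simps)
    also have "\<dots> = (\<Sum>k<n. 1 / L * (\<Sum>i<n. x i * w i k)\<^sup>2)"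
      by (simp only: sum_distrib_left[symmetric] kern_norm[OF row])
    also have "\<dots> \<le> (\<Sum>k<n. 1 / \<mu> k * (\<Sum>i<n. x i * w i k)\<^sup>2)"
    proof (intro sum_mono mult_right_mono)
      fix k assume "k \<in> {..<n}"
      then show "1 / L \<le> 1 / \<mu> k" using le[of k] \<mu>[of k] by (intro divide_left_mono) auto
    qed simp
    finally show "s / (16 * L) * (\<Sum>i\<in>{..<n}. (x i)\<^sup>2) \<le> bil {..<n} (kern n w (\<lambda>k. 1 / \<mu> k)) x x"
      unfolding bil_kern .
  qed simp
next
  case False
  define m where "m = nat \<lfloor>s * real n\<rfloor>"
  have sn: "s * real n \<ge> 1" using False by simp
  have m: "real m \<le> s * real n" "s * real n < real m + 1"
    unfolding m_def using sn by (simp_all add: of_nat_nat)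
  have "real m \<ge> 1"
  proof -
    have "0 < real m" using m sn by linarith
    then show ?thesis by simp
  qed
  \<comment> \<open>Rounding down a number that is at least 1 loses at most half of it.\<close>
  then have m2: "s * real n / 2 \<le> real m" using m by linarith
  have "s * real n \<le> real n" using s by (simp add: mult_left_le_one_le)
  then have mn: "m \<le> n" using m(1) by linarith
  define \<beta> where "\<beta> = s / (16 * L)"
  \<comment> \<open>Indices outside \<open>R\<close> contribute at most \<open>n L\<close> to the
    potential; the at most \<open>s n / 16\<close> indices in \<open>R\<close> contribute at most
    \<open>1 / \<beta> = 16 L / s\<close> each, again \<open>n L\<close> in total.\<close>
  define \<Phi> where "\<Phi> = 2 * real n * L"
  have pos: "\<beta> > 0" "\<Phi> > 0" using s L n by (auto simp: \<beta>_def \<Phi>_def)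
  have d: "1 / \<mu> k > 0" if "k < n" for k using \<mu>[OF that] by simp
  define R where "R = {k. k < n \<and> \<mu> k > L}"
  have R: "R \<subseteq> {..<n}" "finite R" by (auto simp: R_def)
  have "trace_on {..<n} (kern n w (\<lambda>k. 1 / (1 / \<mu> k + \<beta>))) = (\<Sum>k<n. 1 / (1 / \<mu> k + \<beta>))"
    by (rule trace_kern[OF col])
  also have "\<dots> \<le> (\<Sum>k<n. L + (if k \<in> R then 1 / \<beta> else 0))"
  proof (intro sum_mono)
    fix k assume "k \<in> {..<n}"
    then have k: "k < n" by simp
    show "1 / (1 / \<mu> k + \<beta>) \<le> L + (if k \<in> R then 1 / \<beta> else 0)"
    proof (cases "k \<in> R")
      case True
      have "1 / (1 / \<mu> k + \<beta>) \<le> 1 / \<beta>"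
        by (rule frac_le) (use \<mu>[OF k] pos(1) in auto)
      then show ?thesis using True L by simp
    next
      case False
      then have "\<mu> k \<le> L" using k by (simp add: R_def)
      have "1 / (1 / \<mu> k + \<beta>) \<le> 1 / (1 / \<mu> k)"
        by (rule frac_le) (use \<mu>[OF k] pos(1) in auto)
      then show ?thesis using False \<open>\<mu> k \<le> L\<close> by simp
    qed
  qed
  also have "\<dots> = real n * L + real (card R) * (1 / \<beta>)"
    using R by (simp add: sum.distrib sum.If_cases Int_absorb1)
  also have "\<dots> \<le> real n * L + s * real n / 16 * (1 / \<beta>)"
    using few pos(1) by (intro add_left_mono mult_right_mono) (auto simp: R_def)
  also have "\<dots> = \<Phi>" using s L by (simp add: \<beta>_def \<Phi>_def field_simps)
  finally have tr: "trace_on {..<n} (kern n w (\<lambda>k. 1 / (1 / \<mu> k + \<beta>))) \<le> \<Phi>" .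
  have "m \<le> card {..<n}" using mn by simp
  from restricted_invertibility[OF pd_inverse_kern[OF row col d pos(1)] tr pos(2) this]
  obtain J where J: "J \<subseteq> {..<n}" "card J = card {..<n} - m"
    "\<And>x. (real m / (2 * \<Phi>) - \<beta>) * (\<Sum>i\<in>J. (x i)\<^sup>2) \<le> bil J (kern n w (\<lambda>k. 1 / \<mu> k)) x x" by metis
  \<comment> \<open>The barrier travels at least \<open>(s n / 2) / (4 n L) = 2 \<beta>\<close> from
    \<open>- \<beta>\<close>, so it ends at \<open>\<beta>\<close> or higher.\<close>
  have b: "\<beta> \<le> real m / (2 * \<Phi>) - \<beta>"
  proof -
    have "s * real n / 2 / (2 * \<Phi>) \<le> real m / (2 * \<Phi>)"
      using m2 pos(2) by (intro divide_right_mono) auto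
    moreover have "s * real n / 2 / (2 * \<Phi>) = 2 * \<beta>" using n L by (simp add: \<beta>_def \<Phi>_def field_simps)
    ultimately show ?thesis by linarith
  qed
  show thesis
  proof (rule that[OF J(1)])
    show "(1 - s) * real n \<le> real (card J)" using J(2) mn m(1) by (simp add: of_nat_diff algebra_simps)
    fix x :: "nat \<Rightarrow> real"
    have "\<beta> * (\<Sum>i\<in>J. (x i)\<^sup>2) \<le> (real m / (2 * \<Phi>) - \<beta>) * (\<Sum>i\<in>J. (x i)\<^sup>2)"
      using b by (intro mult_right_mono sum_nonneg) auto
    also have "\<dots> \<le> bil J (kern n w (\<lambda>k. 1 / \<mu> k)) x x" by (rule J(3))
    finally show "s / (16 * L) * (\<Sum>i\<in>J. (x i)\<^sup>2) \<le> bil J (kern n w (\<lambda>k. 1 / \<mu> k)) x x"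
      by (simp only: \<beta>_def)
  qed
qed

section \<open>Coordinate subspaces\<close>

lemma orthonormal_basisD:
  assumes "orthonormal_basis n e"
  shows "\<And>i. i < n \<Longrightarrow> e i \<in> carrier_vec n" and "orthonormal n n (\<lambda>j. vec_index (e j))"
proof -
  interpret vec_space "TYPE(real)" n .
  have "basis (e ` {..<n})" using assms by (simp add: orthonormal_basis_def)
  then show c: "e i \<in> carrier_vec n" if "i < n" for i using that by (auto simp: basis_def)
  show "orthonormal n n (\<lambda>j. vec_index (e j))"
    using assms by (auto simp: orthonormal_basis_def orthonormal_def scalar_prod_ip[OF c, symmetric])
qed

text \<open>The \<open>e j\<close> with \<open>j\<close> in \<open>\<sigma>\<close> are independent
  as part of a basis, and the orthonormal expansion of a vector of the subspace has no other
  terms.\<close>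

lemma subspace_dim_coordinate:
  assumes e: "orthonormal_basis n e" and \<sigma>: "\<sigma> \<subseteq> {..<n}"
  shows "subspace_dim n {x \<in> carrier_vec n. \<forall>j\<in>{..<n} - \<sigma>. x \<bullet> e j = 0} = card \<sigma>"
proof -
  interpret vec_space "TYPE(real)" n .
  define G where "G = {x \<in> carrier_vec n. \<forall>j\<in>{..<n} - \<sigma>. x \<bullet> e j = 0}"
  define B where "B = e ` \<sigma>"
  note ec = orthonormal_basisD(1)[OF e] and on = orthonormal_basisD(2)[OF e]
  have ee: "e i \<bullet> e j = (if i = j then 1 else 0)" if "i < n" "j < n" for i j
    using e that by (simp add: orthonormal_basis_def)
  have fin: "finite \<sigma>" using \<sigma> by (rule finite_subset) simp
  have inj: "inj_on e \<sigma>"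
  proof (rule inj_onI)
    fix i j assume ij: "i \<in> \<sigma>" "j \<in> \<sigma>" "e i = e j"
    then have "i < n" "j < n" using \<sigma> by auto
    then show "i = j" using ee[of i j] ee[of i i] ij(3) by (simp split: if_splits)
  qed
  have B: "finite B" "B \<subseteq> carrier_vec n" "card B = card \<sigma>"
    using fin ec \<sigma> card_image[OF inj] by (auto simp: B_def)
  have lin: "lin_indpt B"
  proof -
    have "basis (e ` {..<n})" using e by (simp add: orthonormal_basis_def)
    then have "lin_indpt (e ` {..<n})" by (simp add: basis_def)
    moreover have "B \<subseteq> e ` {..<n}" using \<sigma> by (auto simp: B_def)
    ultimately show ?thesis using subset_li_is_li by blast
  qed
  have span_sub: "span B \<subseteq> G"
  proof
    fix v assume "v \<in> span B"
    then obtain a where v: "v = lincomb a B" using B by (auto simp: finite_span)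
    have "v \<in> carrier_vec n" using v B by (simp add: lincomb_dim)
    moreover have "v \<bullet> e j = 0" if "j \<in> {..<n} - \<sigma>" for j
    proof -
      have "v \<bullet> e j = (\<Sum>w\<in>B. (a w \<cdot>\<^sub>v w) \<bullet> e j)"
        unfolding v lincomb_def using B ec that by (intro finsum_scalar_prod_sum) auto
      also have "\<dots> = 0"
      proof (rule sum.neutral, rule ballI)
        fix w assume "w \<in> B"
        then obtain i where i: "i \<in> \<sigma>" "w = e i" by (auto simp: B_def)
        then have "i < n" "i \<noteq> j" using \<sigma> that by auto
        then show "(a w \<cdot>\<^sub>v w) \<bullet> e j = 0" using that ee[of i j] smult_scalar_prod_distrib[of "e i" n "e j" "a w"] ec by (simp add: i(2))
      qed
      finally show ?thesis .
    qed
    ultimately show "v \<in> G" by (simp add: G_def)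
  qed
  have sub_span: "G \<subseteq> span B"
  proof
    fix x assume x: "x \<in> G"
    then have xc: "x \<in> carrier_vec n" by (simp add: G_def)
    have "x = lincomb (\<lambda>v. x \<bullet> v) B"
    proof (rule eq_vecI)
      show "dim_vec x = dim_vec (lincomb (\<lambda>v. x \<bullet> v) B)" using xc B by (simp add: lincomb_dim)
      fix i assume "i < dim_vec (lincomb (\<lambda>v. x \<bullet> v) B)"
      then have i: "i < n" using B by (simp add: lincomb_dim)
      have "lincomb (\<lambda>v. x \<bullet> v) B $ i = (\<Sum>v\<in>B. (x \<bullet> v) * v $ i)"
        using B by (intro lincomb_index i) auto
      also have "\<dots> = (\<Sum>j\<in>\<sigma>. (x \<bullet> e j) * e j $ i)"
        unfolding B_def by (simp add: sum.reindex[OF inj])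
      also have "\<dots> = (\<Sum>j<n. (x \<bullet> e j) * e j $ i)"
        using x \<sigma> by (intro sum.mono_neutral_left) (auto simp: G_def)
      also have "\<dots> = (\<Sum>j<n. ip n (vec_index x) (vec_index (e j)) * e j $ i)"
        by (intro sum.cong refl) (simp add: scalar_prod_ip ec)
      also have "\<dots> = x $ i" by (rule orthonormal_expand[OF on i, symmetric])
      finally show "x $ i = lincomb (\<lambda>v. x \<bullet> v) B $ i" ..
    qed
    then show "x \<in> span B" unfolding finite_span[OF B(1,2)] by auto
  qed
  have G: "G = span B" using span_sub sub_span by (rule subset_antisym[rotated])
  have sm: "submodule class_ring G V" unfolding G by (rule span_is_submodule) (simp add: B)
  have "subspace class_ring G V" unfolding subspace_def using sm vec_vs by blast
  then have vsG: "vectorspace class_ring (V\<lparr>carrier := G\<rparr>)" by (rule subspace_is_vs)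
  have BG: "B \<subseteq> G" unfolding G by (rule in_own_span) (simp add: B)
  \<comment> \<open>Span and independence of \<open>B\<close> are the same in the subspace as in the
    whole space.\<close>
  have "vectorspace.basis class_ring (V\<lparr>carrier := G\<rparr>) B"
    unfolding vectorspace.basis_def[OF vsG]
    using span_li_not_depend[OF BG sm] lin BG G by simp
  then have "vectorspace.dim class_ring (V\<lparr>carrier := G\<rparr>) = card B"
    by (rule vectorspace.dim_basis[OF vsG B(1)])
  then show ?thesis unfolding subspace_dim_def G_def[symmetric] B(3) .
qed

lemma t_c_ge_card:
  assumes e: "orthonormal_basis n e" and \<sigma>: "\<sigma> \<subseteq> {..<n}"
    and le: "\<And>x. x \<in> carrier_vec n \<Longrightarrow> (\<And>j. j \<in> {..<n} - \<sigma> \<Longrightarrow> x \<bullet> e j = 0) \<Longrightarrow>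
      1 / r * eucl_norm x \<le> body_norm K x"
  shows "card \<sigma> \<le> t_c n e K r"
proof -
  define G where "G = {x \<in> carrier_vec n. \<forall>j\<in>{..<n} - \<sigma>. x \<bullet> e j = 0}"
  have "coordinate_subspace n e G" unfolding coordinate_subspace_def G_def using \<sigma> by blast
  moreover have "subspace_dim n G = card \<sigma>" unfolding G_def by (rule subspace_dim_coordinate[OF e \<sigma>])
  moreover have "\<forall>x\<in>G. 1 / r * eucl_norm x \<le> body_norm K x" using le by (auto simp: G_def)
  moreover have "card \<sigma> \<le> n" using card_mono[OF _ \<sigma>] by simp
  ultimately have "card \<sigma> \<in> {k. k \<le> n \<and> (\<exists>G. coordinate_subspace n e G \<and> subspace_dim n G = k \<and>
                           (\<forall>x\<in>G. 1 / r * eucl_norm x \<le> body_norm K x))}" by blast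
  then show ?thesis unfolding t_c_def by (intro Max_ge) auto
qed

section \<open>The main estimate\<close>

text \<open>The empty set of axes in \<open>M_position_axes\<close> gives it.\<close>

lemma M_position_nonneg:
  assumes "has_axes n u a E" "M_position n \<delta> E" "n \<ge> 1"
  shows "\<delta> \<ge> 0"
  using M_position_axes[OF assms, of "{}"] assms(3) by (simp add: zero_le_mult_iff)

text \<open>Each long axis adds at least \<open>16 \<delta> / s + 1 / 2\<close> to a sum of
  logarithms that is at most \<open>\<delta> n\<close>.\<close>

lemma card_long_axes:
  assumes axes: "has_axes n u a E" and M: "M_position n \<delta> E" and n: "n \<ge> 1" and s: "0 < s"
  defines "\<mu> \<equiv> \<lambda>k. (a k / volume_radius n E)\<^sup>2"
  shows "real (card {k. k < n \<and> \<mu> k > exp (32 * \<delta> / s + 1)}) \<le> s * real n / 16"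
proof -
  define R where "R = {k. k < n \<and> \<mu> k > exp (32 * \<delta> / s + 1)}"
  have a: "\<And>k. k < n \<Longrightarrow> a k > 0" using axes by (auto simp: has_axes_def)
  have vr: "volume_radius n E > 0"
    using n a by (auto simp: volume_radius_has_axes[OF axes] intro!: prod_pos)
  have \<delta>: "\<delta> \<ge> 0" by (rule M_position_nonneg[OF axes M n])
  have "(\<Sum>k\<in>R. 16 * \<delta> / s + 1 / 2) \<le> (\<Sum>k\<in>R. ln (a k / volume_radius n E))"
  proof (intro sum_mono)
    fix k assume "k \<in> R"
    then have k: "k < n" "exp (32 * \<delta> / s + 1) < \<mu> k" by (auto simp: R_def)
    have pos: "a k / volume_radius n E > 0" using a[OF k(1)] vr by simp
    have "32 * \<delta> / s + 1 = ln (exp (32 * \<delta> / s + 1))" by simp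
    also have "\<dots> \<le> ln (\<mu> k)" using k(2) by (intro ln_mono) auto
    also have "\<dots> = 2 * ln (a k / volume_radius n E)"
      using pos unfolding \<mu>_def by (subst ln_realpow) auto
    finally show "16 * \<delta> / s + 1 / 2 \<le> ln (a k / volume_radius n E)" by simp
  qed
  also have "\<dots> \<le> \<delta> * real n"
    by (rule M_position_axes[OF axes M n]) (auto simp: R_def)
  finally have "real (card R) * (16 * \<delta> / s + 1 / 2) \<le> \<delta> * real n" by simp
  then have le: "real (card R) * (16 * \<delta> + s / 2) \<le> \<delta> * real n * s" using s by (simp add: field_simps)
  \<comment> \<open>The \<open>1 / 2\<close> in the exponent keeps this divisor positive when
    \<open>\<delta> = 0\<close>.\<close>
  have "16 * \<delta> + s / 2 > 0" using \<delta> s by simp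
  moreover have "\<delta> * real n * s \<le> s * real n / 16 * (16 * \<delta> + s / 2)"
    using s by (simp add: field_simps)
  ultimately show ?thesis
    using le unfolding R_def[symmetric] by (meson mult_le_cancel_right_pos order_trans)
qed

text \<open>This is \<open>sqrt (16 L / s)\<close> with
  \<open>L = exp (32 \<delta> / s + 1)\<close>: the threshold of \<open>card_long_axes\<close> for
  squared relative lengths, inserted into the bound \<open>s / (16 L)\<close> of
  \<open>coordinate_subset_lower_bound\<close>.\<close>

definition \<phi> :: "real \<Rightarrow> real \<Rightarrow> real" where
  "\<phi> \<delta> s = 4 * exp (16 * \<delta> / s + 1 / 2) / sqrt s"

lemma \<phi>_pos: "s > 0 \<Longrightarrow> \<phi> \<delta> s > 0"
  by (simp add: \<phi>_def)

lemma t_c_has_axes: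
  assumes axes: "has_axes n u a E" and M: "M_position n \<delta> E" and n: "n \<ge> 1"
    and e: "orthonormal_basis n e" and s: "0 < s" "s < 1"
    and r: "r \<ge> volume_radius n E * \<phi> \<delta> s"
  shows "real (t_c n e E r) \<ge> (1 - s) * real n"
proof -
  note ec = orthonormal_basisD(1)[OF e] and on = orthonormal_basisD(2)[OF e]
  have u: "orthonormal n n u" and a: "\<And>k. k < n \<Longrightarrow> a k > 0" using axes by (auto simp: has_axes_def)
  define v where "v = volume_radius n E"
  have v: "v > 0" using n a by (auto simp: v_def volume_radius_has_axes[OF axes] intro!: prod_pos)
  \<comment> \<open>Change of basis between \<open>e\<close> and the principal axes: with it,
    \<open>kern n w (\<lambda>k. 1 / \<mu> k)\<close> is the matrix in the basis \<open>e\<close> of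
    the squared gauge times \<open>v^2\<close>.\<close>
  define w where "w i k = ip n (vec_index (e i)) (u k)" for i k
  define \<mu> where "\<mu> k = (a k / v)\<^sup>2" for k
  define L where "L = exp (32 * \<delta> / s + 1)"
  have row: "(\<Sum>k<n. w i k * w j k) = (if i = j then 1 else 0)" if "i < n" "j < n" for i j
    using on that orthonormal_parseval[OF u, of "vec_index (e i)" "vec_index (e j)"]
    by (simp add: w_def orthonormal_def)
  have col: "(\<Sum>j<n. w j k * w j l) = (if k = l then 1 else 0)" if "k < n" "l < n" for k l
  proof -
    have "(\<Sum>j<n. w j k * w j l) = ip n (u k) (u l)"
      unfolding w_def ip_commute[of n "vec_index (e _)"] by (rule orthonormal_parseval[OF on, symmetric])
    then show ?thesis using u that by (simp add: orthonormal_def)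
  qed
  have few: "real (card {k. k < n \<and> \<mu> k > L}) \<le> s * real n / 16"
    unfolding \<mu>_def L_def v_def by (rule card_long_axes[OF axes M n s(1)])
  have \<mu>: "\<mu> k > 0" if "k < n" for k using a[OF that] v by (simp add: \<mu>_def)
  have L: "L > 0" by (simp add: L_def)
  obtain J where J: "J \<subseteq> {..<n}" "real (card J) \<ge> (1 - s) * real n"
    "\<And>x. s / (16 * L) * (\<Sum>i\<in>J. (x i)\<^sup>2) \<le> bil J (kern n w (\<lambda>k. 1 / \<mu> k)) x x"
    using coordinate_subset_lower_bound[OF row col \<mu> L s n few] by metis
  define b where "b = s / (16 * L)"
  have b: "b > 0" using s L by (simp add: b_def)
  have "card J \<le> t_c n e E r"
  proof (rule t_c_ge_card[OF e J(1)])
    fix x :: "real vec" assume x: "x \<in> carrier_vec n" and 0: "\<And>j. j \<in> {..<n} - J \<Longrightarrow> x \<bullet> e j = 0"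
    define c where "c j = ip n (vec_index x) (vec_index (e j))" for j
    have c0: "c j = 0" if "j \<in> {..<n} - J" for j
      using 0[OF that] scalar_prod_ip[OF ec[of j], of x] that by (simp add: c_def)
    have cJ: "(\<Sum>i<n. (c i)\<^sup>2) = (\<Sum>i\<in>J. (c i)\<^sup>2)"
      using J(1) c0 by (intro sum.mono_neutral_right) auto
    have "eucl_norm x = sqrt (\<Sum>i<n. (c i)\<^sup>2)"
      by (simp add: eucl_norm_axes[OF on x] c_def)
    then have norm: "eucl_norm x = sqrt (\<Sum>i\<in>J. (c i)\<^sup>2)" by (simp add: cJ)
    have xu: "ip n (vec_index x) (u k) = (\<Sum>i<n. c i * w i k)" for k
      using orthonormal_parseval[OF on, of "vec_index x" "u k"]
      by (simp add: c_def w_def ip_commute[of n "u k"])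
    have "v\<^sup>2 * axis_form n u a x = (\<Sum>k<n. 1 / \<mu> k * (\<Sum>i<n. c i * w i k)\<^sup>2)"
      unfolding axis_form_def xu sum_distrib_left
      by (intro sum.cong refl) (simp add: \<mu>_def power_divide)
    also have "\<dots> = bil {..<n} (kern n w (\<lambda>k. 1 / \<mu> k)) c c" by (simp only: bil_kern)
    also have "\<dots> = bil {..<n} (kern n w (\<lambda>k. 1 / \<mu> k)) (\<lambda>i. if i \<in> J then c i else 0) (\<lambda>i. if i \<in> J then c i else 0)"
      using c0 by (intro bil_cong) auto
    also have "\<dots> = bil J (kern n w (\<lambda>k. 1 / \<mu> k)) c c" by (rule bil_subset) (use J(1) in auto)
    also have "\<dots> \<ge> b * (\<Sum>i\<in>J. (c i)\<^sup>2)" unfolding b_def by (rule J(3))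
    finally have "b / v\<^sup>2 * (\<Sum>i\<in>J. (c i)\<^sup>2) \<le> axis_form n u a x"
      using v by (simp add: field_simps)
    then have "sqrt (b / v\<^sup>2 * (\<Sum>i\<in>J. (c i)\<^sup>2)) \<le> sqrt (axis_form n u a x)"
      by (rule real_sqrt_le_mono)
    then have le: "sqrt b / v * eucl_norm x \<le> body_norm E x"
      using v by (simp add: body_norm_has_axes[OF axes x] norm real_sqrt_mult real_sqrt_divide)
    have "sqrt L = exp (16 * \<delta> / s + 1 / 2)"
    proof (rule real_sqrt_unique)
      show "(exp (16 * \<delta> / s + 1 / 2))\<^sup>2 = L"
        by (simp add: L_def power2_eq_square exp_add[symmetric])
    qed simp
    then have "\<phi> \<delta> s = 1 / sqrt b"
      using s L by (simp add: \<phi>_def b_def real_sqrt_divide real_sqrt_mult)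
    then have "v / sqrt b \<le> r" using r by (simp add: v_def)
    moreover have "v / sqrt b > 0" using v b by simp
    ultimately have "1 / r \<le> 1 / (v / sqrt b)" by (intro frac_le) simp_all
    then have "1 / r * eucl_norm x \<le> sqrt b / v * eucl_norm x"
      by (intro mult_right_mono) (auto simp: norm sum_nonneg)
    with le show "1 / r * eucl_norm x \<le> body_norm E x" by (rule order_trans[rotated])
  qed
  then show ?thesis using J(2) by linarith
qed

lemma \<phi>_product_le_u_bound:
  assumes "0 < \<tau>" "\<tau> < 1" "\<delta> \<ge> 0"
  shows "\<phi> \<delta> \<tau> * \<phi> \<delta> (1 / 2) \<le> u_bound 200 \<tau> \<delta>"
proof -
  have ln_ge: "1 / 2 \<le> ln (2 / \<tau>)"
  proof -
    have "1 / 2 \<le> ln (2::real)" using ln_2_less_1 ln2_ge_two_thirds by linarith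
    also have "\<dots> \<le> ln (2 / \<tau>)" using assms by (intro ln_mono) (auto simp: field_simps)
    finally show ?thesis .
  qed
  have sq: "1 / 4 \<le> (ln (2 / \<tau>))\<^sup>2"
    using power_mono[OF ln_ge, of 2] by (simp add: power2_eq_square)
  have "\<phi> \<delta> \<tau> * \<phi> \<delta> (1 / 2) = 16 * sqrt 2 * exp 1 * exp (16 * \<delta> / \<tau> + 32 * \<delta>) / sqrt \<tau>"
    by (simp add: \<phi>_def real_sqrt_divide exp_add[symmetric] mult_exp_exp)
  \<comment> \<open>Here 100 rounds up \<open>16 * 2 * 3\<close>.\<close>
  also have "\<dots> \<le> 100 * exp (16 * \<delta> / \<tau> + 32 * \<delta>) / sqrt \<tau>"
  proof -
    have "sqrt 2 \<le> (2::real)" by (rule real_le_lsqrt) auto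
    moreover have "exp 1 \<le> (3::real)" by (rule exp_le)
    ultimately have "sqrt 2 * exp 1 \<le> 2 * (3::real)" by (intro mult_mono) auto
    then have "16 * sqrt 2 * exp 1 \<le> (100::real)" unfolding mult.assoc by linarith
    then show ?thesis using assms by (intro divide_right_mono mult_right_mono) auto
  qed
  \<comment> \<open>The logarithm is at least \<open>1 / 2\<close>, which is why the constant
    doubles.\<close>
  also have "\<dots> \<le> 200 * ln (2 / \<tau>) * exp (16 * \<delta> / \<tau> + 32 * \<delta>) / sqrt \<tau>"
    using assms ln_ge by (intro divide_right_mono mult_right_mono) auto
  also have "\<dots> \<le> 200 * ln (2 / \<tau>) * exp (200 * \<delta> * (ln (2 / \<tau>))\<^sup>2 / \<tau>) / sqrt \<tau>"
  proof -
    \<comment> \<open>As \<open>\<tau> < 1\<close>, both exponents together are at most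
      \<open>48 \<delta> / \<tau>\<close>; the squared logarithm is at least \<open>1 / 4\<close>,
      so the constant 200 leaves room for 50.\<close>
    have "16 * \<delta> / \<tau> + 32 * \<delta> \<le> 48 * \<delta> / \<tau>"
    proof -
      have "\<delta> \<le> \<delta> / \<tau>" using assms mult_left_le[of \<tau> \<delta>] by (simp add: le_divide_eq)
      then show ?thesis unfolding times_divide_eq_right[symmetric] by linarith
    qed
    also have "\<dots> \<le> 200 * \<delta> * (1 / 4) / \<tau>"
      using assms by (intro divide_right_mono) auto
    also have "\<dots> \<le> 200 * \<delta> * (ln (2 / \<tau>))\<^sup>2 / \<tau>"
      using assms sq by (intro divide_right_mono mult_left_mono) auto
    finally show ?thesis
      using assms ln_ge by (intro divide_right_mono mult_left_mono) auto
  qed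
  also have "\<dots> = u_bound 200 \<tau> \<delta>" by (simp add: u_bound_def)
  finally show ?thesis .
qed

theorem theorem5p3:
  shows "\<exists>c::real. c > 0 \<and>
    (\<forall>(n::nat) (e :: nat \<Rightarrow> real vec) (E :: real vec set) (\<delta>::real).
       n \<ge> 1 \<longrightarrow> orthonormal_basis n e \<longrightarrow> ellipsoid n E \<longrightarrow>
       M_position n \<delta> E \<longrightarrow> M_position n \<delta> (polar n E) \<longrightarrow>
       (\<forall>r \<tau> :: real. r > 0 \<longrightarrow> 0 < \<tau> \<longrightarrow> \<tau> < 1 \<longrightarrow>
          real (t_c n e E r) + real (t_c n e (polar n E) (u_bound c \<tau> \<delta> / r))
            \<ge> (1 - \<tau>) * real n))"
proof (intro exI[of _ 200] conjI allI impI)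
  fix n :: nat and e :: "nat \<Rightarrow> real vec" and E :: "real vec set" and \<delta> r \<tau> :: real
  assume n: "n \<ge> 1" and e: "orthonormal_basis n e" and "ellipsoid n E"
    and M: "M_position n \<delta> E" "M_position n \<delta> (polar n E)" and r: "r > 0" and \<tau>: "0 < \<tau>" "\<tau> < 1"
  obtain u a where axes: "has_axes n u a E" using ellipsoid_has_axes[OF \<open>ellipsoid n E\<close>] by metis
  note polar_axes = has_axes_polar[OF axes]
  define v where "v = volume_radius n E"
  have a: "\<And>k. k < n \<Longrightarrow> a k > 0" using axes by (auto simp: has_axes_def)
  have v: "v > 0" using n a by (auto simp: v_def volume_radius_has_axes[OF axes] intro!: prod_pos)
  have "volume_radius n (polar n E) = 1 / v"
    using n by (simp add: v_def volume_radius_has_axes[OF axes] volume_radius_has_axes[OF polar_axes]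
        prod_dividef real_root_divide)
  note large = t_c_has_axes[OF axes M(1) n e, folded v_def]
    t_c_has_axes[OF polar_axes M(2) n e, unfolded this]
  define U where "U = u_bound 200 \<tau> \<delta>"
  have U: "\<phi> \<delta> \<tau> * \<phi> \<delta> (1 / 2) \<le> U"
    unfolding U_def by (rule \<phi>_product_le_u_bound[OF \<tau> M_position_nonneg[OF axes M(1) n]])
  have pos: "\<phi> \<delta> \<tau> > 0" "\<phi> \<delta> (1 / 2) > 0" using \<tau> by (simp_all add: \<phi>_pos)
  show "(1 - \<tau>) * real n \<le> real (t_c n e E r) + real (t_c n e (polar n E) (u_bound 200 \<tau> \<delta> / r))"
    unfolding U_def[symmetric]
  proof (cases "r \<ge> v * \<phi> \<delta> \<tau> \<or> U / r \<ge> 1 / v * \<phi> \<delta> \<tau>")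
    case True
    then show "(1 - \<tau>) * real n \<le> real (t_c n e E r) + real (t_c n e (polar n E) (U / r))"
      using large(1)[OF \<tau>, of r] large(2)[OF \<tau>, of "U / r"] by (auto intro: add_increasing add_increasing2)
  next
    case False
    then have r1: "r < v * \<phi> \<delta> \<tau>" and r2: "U * v < \<phi> \<delta> \<tau> * r" using v r by (auto simp: field_simps)
    \<comment> \<open>Cancelling \<open>\<phi> \<delta> \<tau>\<close> against \<open>r2\<close>
      gives the threshold for \<open>1/2\<close> at \<open>r\<close>; \<open>r1\<close> gives the
      one for the polar at \<open>U / r\<close>.\<close>
    have "\<phi> \<delta> \<tau> * (\<phi> \<delta> (1 / 2) * v) \<le> U * v"
      using mult_right_mono[OF U, of v] v by (simp add: mult.assoc)
    with r2 have "\<phi> \<delta> \<tau> * (v * \<phi> \<delta> (1 / 2)) < \<phi> \<delta> \<tau> * r" by (simp add: mult.commute)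
    then have 1: "v * \<phi> \<delta> (1 / 2) \<le> r" using pos(1) by simp
    have "\<phi> \<delta> (1 / 2) * r \<le> \<phi> \<delta> (1 / 2) * (v * \<phi> \<delta> \<tau>)" using r1 pos(2) by simp
    also have "\<dots> \<le> U * v" using mult_right_mono[OF U, of v] v by (simp add: mult_ac)
    finally have 2: "1 / v * \<phi> \<delta> (1 / 2) \<le> U / r" using v r by (simp add: field_simps)
    have "(1 - 1 / 2) * real n \<le> real (t_c n e E r)" "(1 - 1 / 2) * real n \<le> real (t_c n e (polar n E) (U / r))"
      using large(1)[OF _ _ 1] large(2)[OF _ _ 2] by simp_all
    moreover have "(1 - \<tau>) * real n \<le> real n" using \<tau> by (simp add: mult_left_le_one_le)
    ultimately show "(1 - \<tau>) * real n \<le> real (t_c n e E r) + real (t_c n e (polar n E) (U / r))" by simp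
  qed
qed simp

end
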